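(* Let $q\ge 6$ be a prime power and let $\bar{\mathcal C}$ be an $\mathbb F_q$-conic in an $\mathbb F_q$-subplane $\bar\pi$ of $\mathrm{PG}(2,q^3)$ that is tangent to $\ell_\infty$. Then in the exact-at-infinity Bruck-Bose representation in $\mathrm{PG}(6,q)$, the points of $[\mathcal C]$ form either a 6-dimensional normal rational curve $\mathcal N_6$, or a 4-dimensional normal rational curve $\mathcal N_4$ and a spread plane.
   Context: **$\mathbb F_q$-conics.** An $\mathbb F_q$-subplane of $\mathrm{PG}(2,q^3)$ is a subplane of order $q$; it is secant, tangent or exterior to a line if it meets it in $q+1$, $1$ or $0$ points. An $\mathbb F_q$-conic is a non-degenerate conic of an $\mathbb F_q$-subplane. A line $\ell_\infty$ of $\mathrm{PG}(2,q^3)$ is fixed as line at infinity. **Normal rational curves.** An $r$-dimensional normal rational curve in $\mathrm{PG}(n,q)$ is a set of points lying in an $r$-space and projectively equivalent to $\{(1,\theta,\dots,\theta^r):\theta\in\mathbb F_q\}\cup\{(0,\dots,0,1)\}$. **Regular 2-spread.** $X^q$ is obtained from $X$ by raising coordinates to the $q$-th power. A regular 2-spread $\mathcal S$ of $\Sigma_\infty\cong\mathrm{PG}(5,q)$ is obtained from a line $g$ of $\mathrm{PG}(5,q^3)$ disjoint from $\Sigma_\infty$ such that $g,g^q,g^{q^2}$ span $\mathrm{PG}(5,q^3)$: its elements (spread planes) are the planes $\langle X,X^q,X^{q^2}\rangle\cap\Sigma_\infty$, $X\in g$. **Exact-at-infinity Bruck-Bose representation.** Let $\Sigma_\infty$ be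 a hyperplane of $\mathrm{PG}(6,q)$ and $\mathcal S$ a regular 2-spread of $\Sigma_\infty$. The incidence structure whose points are the points of $\mathrm{PG}(6,q)\setminus\Sigma_\infty$ and the planes of $\mathcal S$; whose lines are the 3-spaces of $\mathrm{PG}(6,q)$ not contained in $\Sigma_\infty$ that contain a plane of $\mathcal S$, together with the line at infinity $\ell_\infty$ (the set of planes of $\mathcal S$); with incidence induced by $\mathrm{PG}(6,q)$, is isomorphic to $\mathrm{PG}(2,q^3)$. Write $[X]$ for the element representing the point $\bar X$ of $\mathrm{PG}(2,q^3)$: a point of $\mathrm{PG}(6,q)\setminus\Sigma_\infty$ if $\bar X\notin\ell_\infty$, a plane of $\mathcal S$ if $\bar X\in\ell_\infty$. In the exact-at-infinity representation, $[\mathcal C]$ is the set of all points of $\mathrm{PG}(6,q)$ lying in the $[X]$, $\bar X\in\bar{\mathcal C}$ (so whole spread planes are included for points of $\bar{\mathcal C}$ on $\ell_\infty$). *)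

theory Defs
  imports "HOL-Analysis.Analysis"
begin

text \<open>A $k$-space of $\mathrm{PG}(n,F)$ is a vector subspace of $F^{n+1}$ of vector space
  dimension $k+1$; in particular points are subspaces of dimension $1$.\<close>

definition pg_space :: "nat \<Rightarrow> ('a::field ^ 'n) set set" where
  "pg_space k = {U. vec.subspace U \<and> vec.dim U = k + 1}"

definition points_in :: "('a::field ^ 'n) set \<Rightarrow> ('a ^ 'n) set set" where
  "points_in U = {P \<in> pg_space 0. P \<subseteq> U}"

abbreviation plane_points :: "('a::field ^ 3) set set" where
  "plane_points \<equiv> pg_space 0"

definition plane_lines :: "('a::field ^ 3) set set set" where
  "plane_lines = points_in ` pg_space 1"

text \<open>An incidence structure is given by a set of points and a set of lines, each line being
  the set of points incident with it.\<close>

definition incidence_iso ::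
  "('p \<Rightarrow> 'r) \<Rightarrow> 'p set \<Rightarrow> 'p set set \<Rightarrow> 'r set \<Rightarrow> 'r set set \<Rightarrow> bool" where
  "incidence_iso f P L P' L' \<longleftrightarrow> bij_betw f P P' \<and> (\<lambda>l. f ` l) ` L = L'"

definition projective_plane_of_order :: "nat \<Rightarrow> 'p set \<Rightarrow> 'p set set \<Rightarrow> bool" where
  "projective_plane_of_order n P L \<longleftrightarrow>
     (\<forall>l\<in>L. l \<subseteq> P \<and> card l = n + 1) \<and>
     (\<forall>x\<in>P. \<forall>y\<in>P. x \<noteq> y \<longrightarrow> (\<exists>!l. l \<in> L \<and> x \<in> l \<and> y \<in> l)) \<and>
     (\<forall>l\<in>L. \<forall>m\<in>L. l \<noteq> m \<longrightarrow> (\<exists>!x. x \<in> l \<and> x \<in> m)) \<and>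
     (\<exists>Q\<subseteq>P. card Q = 4 \<and> (\<forall>l\<in>L. card (l \<inter> Q) \<le> 2))"

text \<open>The lines of a subplane are the lines of the ambient plane that join two of its points,
  so a subplane is determined by its point set.\<close>

definition induced_lines :: "('a::field ^ 3) set set \<Rightarrow> ('a ^ 3) set set set" where
  "induced_lines B = {l \<inter> B | l. l \<in> plane_lines \<and> (\<exists>x\<in>l \<inter> B. \<exists>y\<in>l \<inter> B. x \<noteq> y)}"

definition subplane_of_order :: "nat \<Rightarrow> ('a::field ^ 3) set set \<Rightarrow> bool" where
  "subplane_of_order n B \<longleftrightarrow>
     B \<subseteq> plane_points \<and> projective_plane_of_order n B (induced_lines B)"

definition quadratic_form :: "('a::field ^ 3 \<Rightarrow> 'a) \<Rightarrow> bool" where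
  "quadratic_form Q \<longleftrightarrow> (\<exists>a b c f g h. \<forall>v. Q v =
     a * (v $ 1)\<^sup>2 + b * (v $ 2)\<^sup>2 + c * (v $ 3)\<^sup>2
       + f * v $ 2 * v $ 3 + g * v $ 3 * v $ 1 + h * v $ 1 * v $ 2)"

text \<open>Non-degeneracy means that the conic has no singular point: no nonzero zero of $Q$ lies in
  the radical of the polar form $Q(v+w)-Q(v)-Q(w)$. The condition $Q(v)=0$ matters in
  characteristic 2, where the polar form always has a nonzero radical (the nucleus).\<close>

definition nondegenerate_form :: "('a::field ^ 3 \<Rightarrow> 'a) \<Rightarrow> bool" where
  "nondegenerate_form Q \<longleftrightarrow>
     (\<forall>v. Q v = 0 \<and> (\<forall>w. Q (v + w) - Q v - Q w = 0) \<longrightarrow> v = 0)"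

definition nondegenerate_conic :: "('a::field ^ 3) set set \<Rightarrow> bool" where
  "nondegenerate_conic D \<longleftrightarrow> (\<exists>Q. quadratic_form Q \<and> nondegenerate_form Q \<and>
     D = {P \<in> plane_points. \<forall>v\<in>P. Q v = 0})"

text \<open>A non-degenerate conic of a subplane $B$ isomorphic to $\mathrm{PG}(2,q)$, where \<open>'q\<close> is
  the field of order $q$: the image of one of $\mathrm{PG}(2,q)$ under an isomorphism onto $B$.
  The choice of isomorphism is immaterial, as collineations of $\mathrm{PG}(2,q)$ preserve
  non-degenerate conics.\<close>

definition conic_of_subplane ::
  "'q::field itself \<Rightarrow> ('c::field ^ 3) set set \<Rightarrow> ('c ^ 3) set set \<Rightarrow> bool" where
  "conic_of_subplane _ B C \<longleftrightarrow>
     (\<exists>(f :: ('q ^ 3) set \<Rightarrow> ('c ^ 3) set) D.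
        incidence_iso f plane_points plane_lines B (induced_lines B) \<and>
        nondegenerate_conic D \<and> C = f ` D)"

text \<open>The vectors $e_0,\dots,e_r$ form a basis of the $r$-space containing the curve, with
  respect to which the points of the curve have the standard coordinates.\<close>

definition coord_point :: "(nat \<Rightarrow> 'a::field ^ 'n) \<Rightarrow> nat \<Rightarrow> (nat \<Rightarrow> 'a) \<Rightarrow> ('a ^ 'n) set" where
  "coord_point e r x = vec.span {\<Sum>i\<le>r. x i *s e i}"

definition normal_rational_curve :: "nat \<Rightarrow> ('a::field ^ 'n) set set \<Rightarrow> bool" where
  "normal_rational_curve r N \<longleftrightarrow>
     (\<exists>e. inj_on e {..r} \<and> vec.independent (e ` {..r}) \<and>
        N = {coord_point e r (\<lambda>i. \<theta> ^ i) | \<theta>. True}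
            \<union> {coord_point e r (\<lambda>i. if i = r then 1 else 0)})"

definition field_embedding :: "('q::field \<Rightarrow> 'c::field) \<Rightarrow> bool" where
  "field_embedding \<iota> \<longleftrightarrow> \<iota> 1 = 1 \<and> (\<forall>x y. \<iota> (x + y) = \<iota> x + \<iota> y) \<and> (\<forall>x y. \<iota> (x * y) = \<iota> x * \<iota> y)"

definition lift_vec :: "('q \<Rightarrow> 'c) \<Rightarrow> 'q ^ 'n \<Rightarrow> 'c ^ 'n" where
  "lift_vec \<iota> v = (\<chi> i. \<iota> (v $ i))"

definition power_vec :: "nat \<Rightarrow> 'c::field ^ 'n \<Rightarrow> 'c ^ 'n" where
  "power_vec m v = (\<chi> i. (v $ i) ^ m)"

definition conj_span :: "nat \<Rightarrow> ('c::field ^ 'n) set \<Rightarrow> ('c ^ 'n) set" where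
  "conj_span q X = vec.span (X \<union> power_vec q ` X \<union> power_vec (q\<^sup>2) ` X)"

text \<open>\<open>H\<close> is a 5-space over the field \<open>'q\<close> of order $q$, embedded by \<open>\<iota>\<close> in the 5-space
  \<open>vec.span (lift_vec \<iota> ` H)\<close> over the field \<open>'c\<close> of order $q^3$. As \<open>H\<close> is defined
  over \<open>'q\<close>, conjugation with respect to coordinates of \<open>H\<close> is the restriction of
  conjugation with respect to the ambient coordinates.\<close>

definition regular_2_spread ::
  "('q::{field,finite} \<Rightarrow> 'c::field) \<Rightarrow> ('q ^ 'n) set \<Rightarrow> ('q ^ 'n) set set \<Rightarrow> bool" where
  "regular_2_spread \<iota> H S \<longleftrightarrow> (\<exists>g \<in> pg_space 1.
     g \<subseteq> vec.span (lift_vec \<iota> ` H) \<and>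
     g \<inter> lift_vec \<iota> ` H = {0} \<and>
     conj_span CARD('q) g = vec.span (lift_vec \<iota> ` H) \<and>
     S = {{v \<in> H. lift_vec \<iota> v \<in> conj_span CARD('q) X} | X. X \<in> points_in g})"

definition bb_points :: "('q::field ^ 7) set \<Rightarrow> ('q ^ 7) set set \<Rightarrow> ('q ^ 7) set set" where
  "bb_points H S = {P \<in> pg_space 0. \<not> P \<subseteq> H} \<union> S"

definition bb_lines :: "('q::field ^ 7) set \<Rightarrow> ('q ^ 7) set set \<Rightarrow> ('q ^ 7) set set set" where
  "bb_lines H S =
     {{P \<in> bb_points H S. P \<subseteq> T} | T. T \<in> pg_space 3 \<and> \<not> T \<subseteq> H \<and> (\<exists>\<pi>\<in>S. \<pi> \<subseteq> T)} \<union> {S}"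

text \<open>\<open>\<phi>\<close> maps a point $\bar X$ of $\mathrm{PG}(2,q^3)$ to the element $[X]$ representing it.\<close>

definition bruck_bose_representation ::
  "('q::field ^ 7) set \<Rightarrow> ('q ^ 7) set set \<Rightarrow> ('c::field ^ 3) set set \<Rightarrow>
   (('c ^ 3) set \<Rightarrow> ('q ^ 7) set) \<Rightarrow> bool" where
  "bruck_bose_representation H S linf \<phi> \<longleftrightarrow>
     incidence_iso \<phi> plane_points plane_lines (bb_points H S) (bb_lines H S) \<and> \<phi> ` linf = S"

definition bb_set ::
  "(('c::field ^ 3) set \<Rightarrow> ('q::field ^ 7) set) \<Rightarrow> ('c ^ 3) set set \<Rightarrow> ('q ^ 7) set set" where
  "bb_set \<phi> C = (\<Union>X\<in>C. points_in (\<phi> X))"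

end

theory Submission
  imports Defs
begin

text \<open>Identify the affine part of \<open>PG(6,q)\<close> with \<open>F\<^bsub>q\<^sup>3\<^esub>\<^sup>2\<close>. By the fundamental theorem of
  projective geometry the conic is \<open>{(a(t), b(t), c(t))}\<close>, where \<open>a, b, c\<close> are independent
  quadratic polynomials over \<open>F\<^bsub>q\<^sup>3\<^esub>\<close> and \<open>c = 0\<close> is the line at infinity. Let \<open>c', c''\<close> be the
  conjugates of \<open>c\<close>. If the point of the subplane at infinity is not on the conic, then \<open>c\<close> has
  no zero over \<open>F\<^sub>q\<close>, and multiplying by \<open>c' c''\<close> makes the last coordinate a norm, which lies in
  \<open>F\<^sub>q\<close>; this exhibits the image as a curve of degree 6 in \<open>PG(6,q)\<close>. Its 7 coefficient vectors
  are independent because \<open>c, c', c''\<close> have no common zeros. If that point is on the conic,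
  place it at \<open>t = \<infinity>\<close>; then \<open>c\<close> is linear in \<open>t\<close>, the degree drops to 4, and the point at
  infinity contributes a whole spread plane.\<close>

section \<open>Finite fields\<close>

text \<open>The isomorphisms in the hypotheses are abstract: neither the parametrization of the
  subplane nor the representation comes with coordinates. Both are treated at once. In the vector
  model, collinearity of elements of the representation is the vanishing of a 3 by 3 determinant
  over \<open>'c\<close>, so the composite of the two maps, lifted to vectors, preserves vanishing
  of determinants in both directions. The fundamental theorem is therefore applied to an embedding
  of a small plane in a large one; the field embedding it yields has the same image as \<iota>, and
  the remaining automorphism of \<open>'q\<close> only permutes the parameters of the conic.
  Independence is proved dually. A relation over \<open>'q\<close> among the coefficient vectors is
  a functional on polynomials that kills \<open>c' c''\<close> times 1, t and \<open>t^2\<close>.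
  Its weights lie in \<open>'q\<close>, so it also kills the conjugate products, and the conjugate
  factors can be cancelled one after another until all monomials are killed. Cancellation rests on
  tangency: the coefficients of \<open>c\<close> satisfy exactly one relation over
  \<open>'q\<close>, up to scalars.\<close>

lemma power_CARD_eq:
  fixes x :: "'a::{field,finite}"
  shows "x ^ CARD('a) = x"
proof (cases "x = 0")
  case True
  then show ?thesis by (simp add: power_0_left)
next
  case False
  \<comment> \<open>Multiplication by a nonzero \<open>x\<close> permutes the nonzero elements, so
    their product absorbs a power of \<open>x\<close>.\<close>
  have "(\<Prod>y\<in>UNIV-{0}. x * y) = (\<Prod>y\<in>UNIV-{0}. y)"
    by (rule prod.reindex_bij_witness[of _ "\<lambda>y. y / x" "\<lambda>y. x * y"]) (use False in auto)
  then have "x ^ (CARD('a) - 1) * \<Prod>(UNIV-{0}) = \<Prod>(UNIV-{0::'a})"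
    by (simp add: prod.distrib)
  then have "x ^ (CARD('a) - 1) = 1"
    by simp
  moreover have "x ^ CARD('a) = x * x ^ (CARD('a) - 1)"
    by (rule power_eq_if[THEN trans]) simp
  ultimately show ?thesis
    by simp
qed

lemma one_less_CARD: "1 < CARD('a::{zero_neq_one,finite})"
proof -
  have "card {0, 1::'a} \<le> CARD('a)" by (rule card_mono) auto
  then show ?thesis by simp
qed

text \<open>Both \<open>(x + 1) ^ q\<close> and \<open>x ^ q + 1\<close> equal \<open>x + 1\<close>
  for every \<open>x\<close>, so the polynomial formed by the middle binomial terms has q zeros. Its
  degree is below q, hence all its coefficients vanish. This needs no factorization of q.\<close>

lemma of_nat_choose_CARD:
  assumes "0 < k" "k < CARD('a::{field,finite})"
  shows "of_nat (CARD('a) choose k) = (0::'a)"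
proof -
  define n where "n = CARD('a)"
  have "0 < n" by (simp add: n_def)
  define p :: "'a poly" where "p = (\<Sum>j\<in>{1..<n}. monom (of_nat (n choose j)) j)"
  have "p = 0"
  proof (rule poly_eqI_degree[of UNIV])
    fix x :: 'a
    have "{..n} = insert 0 (insert n {1..<n})"
      using \<open>0 < n\<close> by auto
    then have "(x + 1) ^ n = x ^ n + 1 + (\<Sum>j\<in>{1..<n}. of_nat (n choose j) * x ^ j)"
      using \<open>0 < n\<close> by (simp add: binomial_ring)
    moreover have "(x + 1) ^ n = x + 1" "x ^ n = x"
      by (simp_all only: n_def power_CARD_eq)
    ultimately show "poly p x = poly 0 x"
      by (simp add: p_def poly_sum poly_monom)
  next
    have "degree p \<le> n - 1"
      unfolding p_def
      by (rule degree_sum_le) (auto intro: order.trans[OF degree_monom_le])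
    with \<open>0 < n\<close> have "degree p < n"
      by linarith
    then show "degree p < CARD('a)"
      by (simp add: n_def)
  qed simp
  then have "coeff p k = 0" by simp
  then show ?thesis
    using assms by (simp add: p_def coeff_sum n_def)
qed

lemma field_embedding_hom:
  assumes "field_embedding f"
  shows "f 0 = 0" "f 1 = 1" "f (x + y) = f x + f y" "f (x * y) = f x * f y"
    "f (- x) = - f x" "f (x - y) = f x - f y" "f (x ^ n) = f x ^ n" "f (of_nat n) = of_nat n"
proof -
  show 1: "f 1 = 1" and add: "\<And>x y. f (x + y) = f x + f y" and mult: "\<And>x y. f (x * y) = f x * f y"
    using assms by (auto simp: field_embedding_def)
  have "f 0 + f 0 = f 0 + 0" using add[of 0 0] by simp
  then show 0: "f 0 = 0" by (simp only: add_left_cancel)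
  show uminus: "f (- x) = - f x" for x
    using add[of x "-x"] 0 by (simp add: eq_neg_iff_add_eq_0 add.commute)
  show "f (x - y) = f x - f y"
    using add[of x "-y"] uminus[of y] by simp
  show "f (x ^ n) = f x ^ n" by (induction n) (simp_all add: 1 mult)
  show "f (of_nat n) = of_nat n" by (induction n) (simp_all add: 0 1 add)
qed

lemma field_embedding_eq_0:
  assumes "field_embedding f"
  shows "f x = 0 \<longleftrightarrow> x = 0"
  using field_embedding_hom(1,2,4)[OF assms] 
  by (metis mult_zero_left right_inverse zero_neq_one)

lemma field_embedding_inj:
  assumes "field_embedding f"
  shows "f x = f y \<longleftrightarrow> x = y"
  using field_embedding_eq_0[OF assms, of "x - y"] field_embedding_hom(6)[OF assms, of x y] by auto

lemma field_embedding_sum: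
  assumes "field_embedding f"
  shows "f (sum g A) = (\<Sum>x\<in>A. f (g x))"
  by (induction A rule: infinite_finite_induct) (simp_all add: field_embedding_hom[OF assms])

text \<open>The image consists of q roots of \<open>X^q - X\<close>, which has no more than q roots.
  In particular, any two embeddings of \<open>'q\<close> in the same field have the same
  image.\<close>

lemma range_field_embedding:
  fixes f :: "'q::{field,finite} \<Rightarrow> 'c::field"
  assumes "field_embedding f"
  shows "range f = {x. x ^ CARD('q) = x}"
proof -
  define p :: "'c poly" where "p = monom 1 CARD('q) - monom 1 1"
  have q: "CARD('q) > 1" by (rule one_less_CARD)
  have p: "poly p x = x ^ CARD('q) - x" for x
    by (simp add: p_def poly_monom)
  have "coeff p CARD('q) = 1" using q by (simp add: p_def)
  then have "p \<noteq> 0" by auto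
  have "degree p \<le> CARD('q)"
    unfolding p_def using q by (intro degree_diff_le) (auto intro: order.trans[OF degree_monom_le])
  then have "card {x. poly p x = 0} \<le> CARD('q)"
    using card_poly_roots_bound[OF \<open>p \<noteq> 0\<close>] by simp
  moreover have "card (range f) = CARD('q)"
    by (rule card_image) (simp add: inj_on_def field_embedding_inj[OF assms])
  moreover have "range f \<subseteq> {x. poly p x = 0}"
    using field_embedding_hom(7)[OF assms, of _ "CARD('q)"] by (auto simp: p power_CARD_eq)
  ultimately have "range f = {x. poly p x = 0}"
    using poly_roots_finite[OF \<open>p \<noteq> 0\<close>] by (intro card_seteq) auto
  then show ?thesis by (simp add: p)
qed

section \<open>Conjugation in a cubic extension of finite fields\<close>

locale cubic_extension =
  fixes \<iota> :: "'q::{field,finite} \<Rightarrow> 'c::{field,finite}"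
  assumes card_ext: "CARD('c) = CARD('q) ^ 3"
    and emb: "field_embedding \<iota>"
begin

lemmas emb_hom = field_embedding_hom[OF emb]
lemmas emb_eq_0 = field_embedding_eq_0[OF emb]
lemmas emb_inj = field_embedding_inj[OF emb]

definition fr :: "'c \<Rightarrow> 'c" where "fr x = x ^ CARD('q)"

lemma fr_add: "fr (x + y) = fr x + fr y"
proof -
  define n where "n = CARD('q)"
  have "0 < n" by (simp add: n_def)
  \<comment> \<open>The exponent is the order of \<open>'q\<close>, so the binomial coefficients are
    known to vanish there; \<iota> transports this to \<open>'c\<close>.\<close>
  have zero: "of_nat (n choose j) = (0::'c)" if "0 < j" "j < n" for j
    using of_nat_choose_CARD[of j, where 'a='q] emb_hom(8)[of "n choose j"] emb_hom(1) that
    by (simp add: n_def)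
  have "(x + y) ^ n = (\<Sum>j\<le>n. of_nat (n choose j) * x ^ j * y ^ (n - j))"
    by (rule binomial_ring)
  also have "\<dots> = (\<Sum>j\<in>{0,n}. of_nat (n choose j) * x ^ j * y ^ (n - j))"
    by (rule sum.mono_neutral_right) (auto simp: zero)
  also have "\<dots> = x ^ n + y ^ n"
    using \<open>0 < n\<close> by simp
  finally show ?thesis by (simp add: fr_def n_def)
qed

lemma fr_mult: "fr (x * y) = fr x * fr y"
  by (simp add: fr_def power_mult_distrib)

lemma fr_emb [simp]: "fr (\<iota> a) = \<iota> a"
  using range_field_embedding[OF emb] by (auto simp: fr_def)

lemma fr_field_embedding: "field_embedding fr"
  by (simp add: field_embedding_def fr_add fr_mult) (simp add: fr_def)

lemmas fr_hom = field_embedding_hom[OF fr_field_embedding]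
lemmas fr_eq_0 = field_embedding_eq_0[OF fr_field_embedding]
lemmas fr_sum = field_embedding_sum[OF fr_field_embedding]

lemma fr_fixed_iff: "fr x = x \<longleftrightarrow> x \<in> range \<iota>"
  using range_field_embedding[OF emb] by (simp add: fr_def)

lemma fr3 [simp]: "fr (fr (fr x)) = x"
proof -
  have "fr (fr (fr x)) = x ^ (CARD('q) ^ 3)"
    by (simp add: fr_def power3_eq_cube flip: power_mult)
  then show ?thesis by (simp add: power_CARD_eq flip: card_ext)
qed

lemma fr_fr: "fr (fr x) = x ^ (CARD('q)\<^sup>2)"
  by (simp add: fr_def power2_eq_square flip: power_mult)

end

section \<open>Collinearity and the fundamental theorem of projective geometry\<close>

text \<open>The determinant is expanded by hand so that all identities about it are polynomial
  identities in the nine coordinates.\<close>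

definition det3 :: "'a::comm_ring_1 ^ 3 \<Rightarrow> 'a ^ 3 \<Rightarrow> 'a ^ 3 \<Rightarrow> 'a" where
  "det3 u v w = u$1 * (v$2 * w$3 - v$3 * w$2) - u$2 * (v$1 * w$3 - v$3 * w$1)
     + u$3 * (v$1 * w$2 - v$2 * w$1)"

text \<open>Cramer's rule.\<close>

lemma det3_combination:
  fixes u v w :: "'a::field ^ 3"
  assumes "det3 u v w \<noteq> 0"
  shows "x = (det3 x v w / det3 u v w) *s u + (det3 u x w / det3 u v w) *s v
    + (det3 u v x / det3 u v w) *s w"
proof -
  have "det3 u v w *s x = det3 x v w *s u + det3 u x w *s v + det3 u v x *s w"
    by (simp add: vec_eq_iff forall_3 det3_def algebra_simps)
  then have "x = inverse (det3 u v w) *s (det3 x v w *s u + det3 u x w *s v + det3 u v x *s w)"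
    using assms by (metis vec.scale_scale left_inverse vec.scale_one)
  then show ?thesis
    by (simp add: vec.scale_right_distrib divide_inverse mult.commute)
qed

lemma det3_add:
  "det3 (u + u') v w = det3 u v w + det3 u' v w"
  "det3 u (v + v') w = det3 u v w + det3 u v' w"
  "det3 u v (w + w') = det3 u v w + det3 u v w'"
  by (simp_all add: det3_def algebra_simps)

lemma det3_scale:
  "det3 (a *s u) v w = a * det3 u v w"
  "det3 u (a *s v) w = a * det3 u v w"
  "det3 u v (a *s w) = a * det3 u v w"
  by (simp_all add: det3_def algebra_simps)

lemma det3_same: "det3 u u w = 0" "det3 u v u = 0" "det3 u v v = 0"
  by (simp_all add: det3_def algebra_simps)

text \<open>Multiplicativity of the determinant, with one factor from the coordinate triples and one
  from \<open>u\<close>, \<open>v\<close>, \<open>w\<close>.\<close>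

lemma det3_linear_combination:
  "det3 (a1 *s u + a2 *s v + a3 *s w) (b1 *s u + b2 *s v + b3 *s w) (c1 *s u + c2 *s v + c3 *s w)
    = det3 (vector [a1, a2, a3]) (vector [b1, b2, b3]) (vector [c1, c2, c3]) * det3 u v w"
  by (simp add: det3_def algebra_simps)

lemma det3_independent:
  fixes u v w :: "'a::field ^ 3"
  assumes "det3 u v w \<noteq> 0" "a *s u + b *s v + c *s w = 0"
  shows "a = 0" "b = 0" "c = 0"
proof -
  have "det3 (a *s u + b *s v + c *s w) v w = a * det3 u v w"
    "det3 u (a *s u + b *s v + c *s w) w = b * det3 u v w"
    "det3 u v (a *s u + b *s v + c *s w) = c * det3 u v w"
    by (simp_all add: det3_def algebra_simps)
  then show "a = 0" "b = 0" "c = 0"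
    using assms by (simp_all add: det3_def)
qed

lemma det3_eq_0_iff:
  fixes u v w :: "'a::field ^ 3"
  shows "det3 u v w = 0 \<longleftrightarrow> (\<exists>U\<in>pg_space 1. u \<in> U \<and> v \<in> U \<and> w \<in> U)"
proof
  assume det: "det3 u v w = 0"
  obtain B where B: "B \<subseteq> {u, v, w}" "vec.independent B" "{u, v, w} \<subseteq> vec.span B"
    "card B = vec.dim {u, v, w}"
    using vec.basis_exists by blast
  have "card B \<le> 2"
  proof (rule ccontr)
    assume "\<not> card B \<le> 2"
    moreover have "card B \<le> card {u, v, w}" using B(1) by (intro card_mono) auto
    moreover have "card {u, v, w} \<le> 3" by (rule card_insert_le_m1) (auto simp: card_insert_if)
    ultimately have 3: "card B = 3" by linarith
    then have "vec.dim (vec.span B) = vec.dim (UNIV :: ('a ^ 3) set)"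
      using B(2) vec.dim_eq_card_independent[OF B(2)] by (simp add: card_cart_basis)
    then have "vec.span B = UNIV"
      by (intro vec.subspace_dim_equal) auto
    moreover have "vec.span B \<subseteq> vec.span {u, v, w}" using B(1) by (rule vec.span_mono)
    ultimately have span: "vec.span {u, v, w} = UNIV" by auto
    have *: "\<exists>a b c. x = a *s u + b *s v + c *s w" for x :: "'a ^ 3"
    proof -
      have "x \<in> vec.span {u, v, w}" using span by simp
      then show ?thesis
        by (auto simp: vec.span_insert vec.span_singleton algebra_simps)
    qed
    obtain a1 b1 c1 where e1: "vector [1, 0, 0] = a1 *s u + b1 *s v + c1 *s w" using * by blast
    obtain a2 b2 c2 where e2: "vector [0, 1, 0] = a2 *s u + b2 *s v + c2 *s w" using * by blast
    obtain a3 b3 c3 where e3: "vector [0, 0, 1] = a3 *s u + b3 *s v + c3 *s w" using * by blast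
    \<comment> \<open>By multiplicativity the determinant of the unit vectors, which is 1, would
      have the factor \<open>det3 u v w\<close>.\<close>
    have "det3 (vector [1, 0, 0]) (vector [0, 1, 0]) (vector [0, 0, 1 :: 'a]) = 0"
      unfolding e1 e2 e3 det3_linear_combination det by simp
    then show False by (simp add: det3_def)
  qed
  \<comment> \<open>The three vectors may span less than dimension 2, so \<open>B\<close> is padded
    to exactly two vectors inside a basis of the whole space.\<close>
  define B' where "B' = vec.extend_basis B"
  have B': "B \<subseteq> B'" "vec.independent B'" "vec.span B' = UNIV"
    using vec.extend_basis_superset[OF B(2)] vec.independent_extend_basis[OF B(2)]
      vec.span_extend_basis[OF B(2)] by (auto simp: B'_def)
  then have "card B' = 3"
    using vec.dim_eq_card_independent[OF B'(2)] vec.dim_span[of B'] by (simp add: card_cart_basis)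
  moreover have "finite B'" using B'(2) vec.finiteI_independent by blast
  ultimately obtain B'' where B'': "B \<subseteq> B''" "B'' \<subseteq> B'" "card B'' = 2"
    using exists_subset_between[of B 2 B'] B'(1) \<open>card B \<le> 2\<close> by auto
  then have "vec.independent B''" using B'(2) vec.independent_mono by blast
  then have "vec.span B'' \<in> pg_space 1"
    using B''(3) vec.dim_eq_card_independent[of B''] by (simp add: pg_space_def)
  moreover have "{u, v, w} \<subseteq> vec.span B''"
    using B(3) vec.span_mono[OF B''(1)] by blast
  ultimately show "\<exists>U\<in>pg_space 1. u \<in> U \<and> v \<in> U \<and> w \<in> U" by blast
next
  assume "\<exists>U\<in>pg_space 1. u \<in> U \<and> v \<in> U \<and> w \<in> U"
  then obtain U where U: "vec.subspace U" "vec.dim U = 2" "u \<in> U" "v \<in> U" "w \<in> U"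
    by (auto simp: pg_space_def)
  show "det3 u v w = 0"
  proof (rule ccontr)
    assume det: "det3 u v w \<noteq> 0"
    have "x \<in> U" for x
      by (subst det3_combination[OF det, of x])
        (intro vec.subspace_add[OF U(1)] vec.subspace_scale[OF U(1)] U)
    then have "U = UNIV" by blast
    then show False using U(2) by (simp add: card_cart_basis)
  qed
qed

text \<open>Projecting from the vertices of the frame shows that each ratio of two coordinates of
  \<open>g v\<close> depends only on the same ratio for \<open>v\<close>; this gives \<alpha>,
  \<beta>, \<gamma>. Comparing them on \<open>(1, x, y)\<close> forces all three to agree and to be
  multiplicative, and one further collinearity gives additivity.\<close>

lemma collineation_standard_frame:
  fixes g :: "'q::field ^ 3 \<Rightarrow> 'c::field ^ 3"
  assumes col: "\<And>u v w. u \<noteq> 0 \<Longrightarrow> v \<noteq> 0 \<Longrightarrow> w \<noteq> 0 \<Longrightarrow>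
      det3 u v w = 0 \<longleftrightarrow> det3 (g u) (g v) (g w) = 0"
    and g1: "g (vector [1, 0, 0]) = k1 *s vector [1, 0, 0]"
    and g2: "g (vector [0, 1, 0]) = k2 *s vector [0, 1, 0]"
    and g3: "g (vector [0, 0, 1]) = k3 *s vector [0, 0, 1]"
    and g4: "g (vector [1, 1, 1]) = k4 *s vector [1, 1, 1]"
  shows "\<exists>\<sigma>. field_embedding \<sigma> \<and> (\<forall>v. v \<noteq> 0 \<longrightarrow> (\<exists>k. k \<noteq> 0 \<and> g v = k *s lift_vec \<sigma> v))"
proof -
  have nz: "(vector [a, b, c] :: 'q ^ 3) = 0 \<longleftrightarrow> a = 0 \<and> b = 0 \<and> c = 0" for a b c
    by (simp add: vec_eq_iff forall_3)
  have "det3 (g (vector [1, 0, 0])) (g (vector [0, 1, 0])) (g (vector [0, 0, 1])) \<noteq> 0"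
    by (subst col[symmetric]) (simp_all add: nz, simp add: det3_def)
  then have k: "k1 \<noteq> 0" "k2 \<noteq> 0" "k3 \<noteq> 0"
    by (auto simp: g1 g2 g3 det3_def)
  have "det3 (g (vector [1, 0, 0])) (g (vector [0, 1, 0])) (g (vector [1, 1, 1])) \<noteq> 0"
    by (subst col[symmetric]) (simp_all add: nz, simp add: det3_def)
  then have k4: "k4 \<noteq> 0" by (auto simp: g4 det3_def)
  \<comment> \<open>The side of the frame triangle through the second and third vertices is mapped
    to the same side.\<close>
  have z1: "g v $ 1 = 0 \<longleftrightarrow> v $ 1 = 0" if "v \<noteq> 0" for v
    using col[of "vector [0, 1, 0]" "vector [0, 0, 1]" v] that k by (auto simp: nz g2 g3 det3_def)
  have z2: "g v $ 2 = 0 \<longleftrightarrow> v $ 2 = 0" if "v \<noteq> 0" for v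
    using col[of "vector [1, 0, 0]" "vector [0, 0, 1]" v] that k by (auto simp: nz g1 g3 det3_def)
  have z3: "g v $ 3 = 0 \<longleftrightarrow> v $ 3 = 0" if "v \<noteq> 0" for v
    using col[of "vector [1, 0, 0]" "vector [0, 1, 0]" v] that k by (auto simp: nz g1 g2 det3_def)
  define \<alpha> where "\<alpha> x = g (vector [1, x, 0]) $ 2 / g (vector [1, x, 0]) $ 1" for x
  define \<beta> where "\<beta> x = g (vector [1, 0, x]) $ 3 / g (vector [1, 0, x]) $ 1" for x
  define \<gamma> where "\<gamma> x = g (vector [0, 1, x]) $ 3 / g (vector [0, 1, x]) $ 2" for x
  \<comment> \<open>The points \<open>v\<close>, \<open>(1, v2 / v1, 0)\<close> and the third vertex
    are collinear, and \<open>g\<close> fixes that vertex up to a scalar.\<close>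
  have a: "g v $ 2 = \<alpha> (v $ 2 / v $ 1) * g v $ 1" if "v $ 1 \<noteq> 0" for v
  proof -
    have v: "v \<noteq> 0" using that by auto
    have "det3 (g (vector [0, 0, 1])) (g (vector [1, v $ 2 / v $ 1, 0])) (g v) = 0"
      using that v by (subst col[symmetric]) (simp_all add: nz, simp add: det3_def)
    then show ?thesis
      using z1[of "vector [1, v $ 2 / v $ 1, 0]"] k
      by (simp add: g3 det3_def nz \<alpha>_def field_simps)
  qed
  have b: "g v $ 3 = \<beta> (v $ 3 / v $ 1) * g v $ 1" if "v $ 1 \<noteq> 0" for v
  proof -
    have v: "v \<noteq> 0" using that by auto
    have "det3 (g (vector [0, 1, 0])) (g (vector [1, 0, v $ 3 / v $ 1])) (g v) = 0"
      using that v by (subst col[symmetric]) (simp_all add: nz, simp add: det3_def)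
    then show ?thesis
      using z1[of "vector [1, 0, v $ 3 / v $ 1]"] k
      by (simp add: g2 det3_def nz \<beta>_def field_simps)
  qed
  have c: "g v $ 3 = \<gamma> (v $ 3 / v $ 2) * g v $ 2" if "v $ 2 \<noteq> 0" for v
  proof -
    have v: "v \<noteq> 0" using that by auto
    have "det3 (g (vector [1, 0, 0])) (g (vector [0, 1, v $ 3 / v $ 2])) (g v) = 0"
      using that v by (subst col[symmetric]) (simp_all add: nz, simp add: det3_def)
    then show ?thesis
      using z2[of "vector [0, 1, v $ 3 / v $ 2]"] k
      by (simp add: g1 det3_def nz \<gamma>_def field_simps)
  qed
  have one: "\<alpha> 1 = 1" "\<gamma> 1 = 1"
    using a[of "vector [1, 1, 1]"] c[of "vector [1, 1, 1]"] k4 by (simp_all add: g4)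
  have bca: "\<beta> y = \<gamma> (y / x) * \<alpha> x" if "x \<noteq> 0" for x y
    using a[of "vector [1, x, y]"] b[of "vector [1, x, y]"] c[of "vector [1, x, y]"] that
      z1[of "vector [1, x, y]"] by (simp add: nz)
  have \<gamma>: "\<gamma> = \<beta>" using bca[of 1] by (auto simp: one)
  have zero: "\<alpha> 0 = 0" "\<beta> 0 = 0"
    by (simp_all add: \<alpha>_def \<beta>_def g1)
  have \<beta>: "\<beta> = \<alpha>"
  proof
    fix x show "\<beta> x = \<alpha> x"
      using bca[of x x] one zero by (cases "x = 0") auto
  qed
  have mult: "\<alpha> (x * y) = \<alpha> x * \<alpha> y" for x y
    using bca[of y "x * y"] zero by (cases "y = 0") (auto simp: \<gamma> \<beta>)
  have add: "\<alpha> (x + y) = \<alpha> x + \<alpha> y" for x y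
  proof -
    \<comment> \<open>\<open>?w\<close> equals \<open>?v\<close> plus \<open>x\<close> times
      \<open>?u\<close>. Their images are proportional to \<open>(0, 1, 1)\<close>,
      \<open>(1, 0, \<alpha> y)\<close> and \<open>(1, \<alpha> x, \<alpha> (x + y))\<close>, whose
      determinant vanishes exactly if \<alpha> is additive at \<open>x\<close>,
      \<open>y\<close>.\<close>
    let ?u = "vector [0, 1, 1]" and ?v = "vector [1, 0, y]" and ?w = "vector [1, x, x + y]"
    have "det3 (g ?u) (g ?v) (g ?w) = 0"
      by (subst col[symmetric]) (simp_all add: nz, simp add: det3_def)
    moreover have "g ?u $ 1 = 0" "g ?u $ 3 = g ?u $ 2" "g ?u $ 2 \<noteq> 0"
      using z1[of ?u] z2[of ?u] c[of ?u] by (simp_all add: nz one)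
    moreover have "g ?v $ 2 = 0" "g ?v $ 3 = \<alpha> y * g ?v $ 1" "g ?v $ 1 \<noteq> 0"
      using z1[of ?v] z2[of ?v] b[of ?v] by (simp_all add: nz \<beta>)
    moreover have "g ?w $ 2 = \<alpha> x * g ?w $ 1" "g ?w $ 3 = \<alpha> (x + y) * g ?w $ 1" "g ?w $ 1 \<noteq> 0"
      using z1[of ?w] a[of ?w] b[of ?w] by (simp_all add: nz \<beta>)
    ultimately have "g ?u $ 2 * g ?v $ 1 * g ?w $ 1 * (\<alpha> (x + y) - (\<alpha> x + \<alpha> y)) = 0"
      by (simp add: det3_def algebra_simps)
    then show ?thesis
      using \<open>g ?u $ 2 \<noteq> 0\<close> \<open>g ?v $ 1 \<noteq> 0\<close> \<open>g ?w $ 1 \<noteq> 0\<close> by simp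
  qed
  have emb: "field_embedding \<alpha>"
    by (simp add: field_embedding_def one mult add)
  have nz\<alpha>: "\<alpha> x = 0 \<longleftrightarrow> x = 0" for x
    by (rule field_embedding_eq_0[OF emb])
  have quot: "\<alpha> (x / y) * \<alpha> y = \<alpha> x" if "y \<noteq> 0" for x y
    using that by (simp flip: mult)
  have "\<exists>k. k \<noteq> 0 \<and> g v = k *s lift_vec \<alpha> v" if v: "v \<noteq> 0" for v
  proof (cases "v $ 1 = 0")
    case False
    then have "g v = (g v $ 1 / \<alpha> (v $ 1)) *s lift_vec \<alpha> v"
      using a[OF False] b[OF False] nz\<alpha>[of "v $ 1"] quot[OF False, of "v $ 2"] quot[OF False, of "v $ 3"]
      by (simp add: vec_eq_iff forall_3 lift_vec_def \<beta> field_simps)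
    then show ?thesis
      using z1[OF v] nz\<alpha>[of "v $ 1"] False by (intro exI[of _ "g v $ 1 / \<alpha> (v $ 1)"]) simp
  next
    case v1: True
    show ?thesis
    proof (cases "v $ 2 = 0")
      case False
      then have "g v = (g v $ 2 / \<alpha> (v $ 2)) *s lift_vec \<alpha> v"
        using c[OF False] z1[OF v] v1 nz\<alpha>[of "v $ 2"] quot[OF False, of "v $ 3"]
        by (simp add: vec_eq_iff forall_3 lift_vec_def \<gamma> \<beta> zero field_simps)
      then show ?thesis
        using z2[OF v] nz\<alpha>[of "v $ 2"] False by (intro exI[of _ "g v $ 2 / \<alpha> (v $ 2)"]) simp
    next
      case True
      then have v3: "v $ 3 \<noteq> 0" using v v1 by (auto simp: vec_eq_iff forall_3)
      then have "g v = (g v $ 3 / \<alpha> (v $ 3)) *s lift_vec \<alpha> v"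
        using z1[OF v] z2[OF v] v1 True nz\<alpha>[of "v $ 3"]
        by (simp add: vec_eq_iff forall_3 lift_vec_def zero field_simps)
      then show ?thesis
        using z3[OF v] nz\<alpha>[of "v $ 3"] v3 by (intro exI[of _ "g v $ 3 / \<alpha> (v $ 3)"]) simp
    qed
  qed
  with emb show ?thesis by blast
qed

text \<open>The images of the unit vectors are rescaled so that the image of the unit point is their
  sum. In this basis the map fixes the standard frame up to scalars. The two fields may differ, so
  the semilinear part is only an embedding.\<close>

theorem fundamental_theorem_projective_plane:
  fixes h :: "'q::field ^ 3 \<Rightarrow> 'c::field ^ 3"
  assumes col: "\<And>u v w. u \<noteq> 0 \<Longrightarrow> v \<noteq> 0 \<Longrightarrow> w \<noteq> 0 \<Longrightarrow>
      det3 u v w = 0 \<longleftrightarrow> det3 (h u) (h v) (h w) = 0"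
  shows "\<exists>\<sigma> A1 A2 A3. field_embedding \<sigma> \<and> det3 A1 A2 A3 \<noteq> 0 \<and> (\<forall>v. v \<noteq> 0 \<longrightarrow>
    (\<exists>k. k \<noteq> 0 \<and> h v = k *s (\<sigma> (v $ 1) *s A1 + \<sigma> (v $ 2) *s A2 + \<sigma> (v $ 3) *s A3)))"
proof -
  have nz: "(vector [a, b, c] :: 'q ^ 3) = 0 \<longleftrightarrow> a = 0 \<and> b = 0 \<and> c = 0" for a b c
    by (simp add: vec_eq_iff forall_3)
  define e1 :: "'q ^ 3" where "e1 = vector [1, 0, 0]"
  define e2 :: "'q ^ 3" where "e2 = vector [0, 1, 0]"
  define e3 :: "'q ^ 3" where "e3 = vector [0, 0, 1]"
  define e :: "'q ^ 3" where "e = vector [1, 1, 1]"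
  note e_defs = e1_def e2_def e3_def e_def
  have nz_e: "e1 \<noteq> 0" "e2 \<noteq> 0" "e3 \<noteq> 0" "e \<noteq> 0" by (simp_all add: e_defs nz)
  define D where "D = det3 (h e1) (h e2) (h e3)"
  have D: "D \<noteq> 0" unfolding D_def
    by (subst col[symmetric]) (simp_all add: nz_e, simp add: e_defs det3_def)
  \<comment> \<open>These are the coordinates of the image of the unit point. None of them vanishes,
    because the unit point lies on no side of the triangle of reference.\<close>
  define k1 where "k1 = det3 (h e) (h e2) (h e3) / D"
  define k2 where "k2 = det3 (h e1) (h e) (h e3) / D"
  define k3 where "k3 = det3 (h e1) (h e2) (h e) / D"
  have "det3 (h e) (h e2) (h e3) \<noteq> 0"
    by (subst col[symmetric]) (simp_all add: nz_e, simp add: e_defs det3_def)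
  moreover have "det3 (h e1) (h e) (h e3) \<noteq> 0"
    by (subst col[symmetric]) (simp_all add: nz_e, simp add: e_defs det3_def)
  moreover have "det3 (h e1) (h e2) (h e) \<noteq> 0"
    by (subst col[symmetric]) (simp_all add: nz_e, simp add: e_defs det3_def)
  ultimately have k: "k1 \<noteq> 0" "k2 \<noteq> 0" "k3 \<noteq> 0"
    using D by (simp_all add: k1_def k2_def k3_def)
  have h_e: "h e = k1 *s h e1 + k2 *s h e2 + k3 *s h e3"
    unfolding k1_def k2_def k3_def D_def by (rule det3_combination) (use D in \<open>simp add: D_def\<close>)
  define A1 where "A1 = k1 *s h e1"
  define A2 where "A2 = k2 *s h e2"
  define A3 where "A3 = k3 *s h e3"
  define E where "E = det3 A1 A2 A3"
  have "E = k1 * k2 * k3 * D"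
    by (simp add: E_def A1_def A2_def A3_def D_def det3_def algebra_simps)
  then have E: "E \<noteq> 0" using k D by simp
  define g :: "'q ^ 3 \<Rightarrow> 'c ^ 3" where
    "g v = vector [det3 (h v) A2 A3 / E, det3 A1 (h v) A3 / E, det3 A1 A2 (h v) / E]" for v
  have h: "h v = g v $ 1 *s A1 + g v $ 2 *s A2 + g v $ 3 *s A3" for v
    using det3_combination[of A1 A2 A3 "h v"] E by (simp add: E_def g_def)
  have det: "det3 (h u) (h v) (h w) = det3 (g u) (g v) (g w) * E" for u v w
  proof -
    have "vector [g x $ 1, g x $ 2, g x $ 3] = g x" for x
      by (simp add: vec_eq_iff forall_3)
    then show ?thesis
      unfolding E_def h det3_linear_combination by simp
  qed
  have 1: "det3 u v w = 0 \<longleftrightarrow> det3 (g u) (g v) (g w) = 0" if "u \<noteq> 0" "v \<noteq> 0" "w \<noteq> 0" for u v w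
    using col[OF that] det[of u v w] E by simp
  have he: "h e1 = (1 / k1) *s A1" "h e2 = (1 / k2) *s A2" "h e3 = (1 / k3) *s A3"
    using k by (simp_all add: A1_def A2_def A3_def)
  have h_e': "h e = A1 + A2 + A3"
    using h_e by (simp add: A1_def A2_def A3_def)
  have 2: "g e1 = (1 / k1) *s vector [1, 0, 0]"
    unfolding g_def he det3_scale det3_same E_def[symmetric] using E by (simp add: vec_eq_iff forall_3)
  have 3: "g e2 = (1 / k2) *s vector [0, 1, 0]"
    unfolding g_def he det3_scale det3_same E_def[symmetric] using E by (simp add: vec_eq_iff forall_3)
  have 4: "g e3 = (1 / k3) *s vector [0, 0, 1]"
    unfolding g_def he det3_scale det3_same E_def[symmetric] using E by (simp add: vec_eq_iff forall_3)
  have 5: "g e = 1 *s vector [1, 1, 1]"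
    unfolding g_def h_e' det3_add det3_same E_def[symmetric] using E by (simp add: vec_eq_iff forall_3)
  have "\<exists>\<sigma>. field_embedding \<sigma> \<and> (\<forall>v. v \<noteq> 0 \<longrightarrow> (\<exists>k. k \<noteq> 0 \<and> g v = k *s lift_vec \<sigma> v))"
    by (rule collineation_standard_frame[OF 1 2[unfolded e_defs] 3[unfolded e_defs] 4[unfolded e_defs]
      5[unfolded e_defs]])
  then obtain \<sigma> where \<sigma>: "field_embedding \<sigma>" "\<And>v. v \<noteq> 0 \<Longrightarrow> \<exists>k. k \<noteq> 0 \<and> g v = k *s lift_vec \<sigma> v"
    by blast
  have "\<exists>k. k \<noteq> 0 \<and> h v = k *s (\<sigma> (v $ 1) *s A1 + \<sigma> (v $ 2) *s A2 + \<sigma> (v $ 3) *s A3)"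
    if v: "v \<noteq> 0" for v
  proof -
    obtain m where m: "m \<noteq> 0" "g v = m *s lift_vec \<sigma> v" using \<sigma>(2)[OF v] by blast
    have "h v = m *s (\<sigma> (v $ 1) *s A1 + \<sigma> (v $ 2) *s A2 + \<sigma> (v $ 3) *s A3)"
      by (subst h) (simp add: m lift_vec_def vec.scale_right_distrib)
    with m(1) show ?thesis by blast
  qed
  then show ?thesis using \<sigma>(1) E unfolding E_def by blast
qed

section \<open>Ternary quadratic forms over finite fields\<close>

text \<open>More than half of all elements are squares, so the translates \<open>a S\<close> and
  \<open>c - b S\<close> of the set \<open>S\<close> of squares, both of size \<open>card S\<close>,
  must meet.\<close>

lemma binary_diagonal_represents:
  fixes a b c :: "'a::{field,finite}"
  assumes "a \<noteq> 0" "b \<noteq> 0"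
  obtains x y where "a * x\<^sup>2 + b * y\<^sup>2 = c"
proof -
  define S where "S = range (\<lambda>x::'a. x\<^sup>2)"
  define r where "r s = (SOME x::'a. x\<^sup>2 = s)" for s
  have r: "(r (x\<^sup>2))\<^sup>2 = x\<^sup>2" for x
    unfolding r_def by (rule someI[of _ x]) simp
  \<comment> \<open>Every element is plus or minus the chosen root of its square, and 0 needs only
    one sign. The count is thus at most \<open>2 * card S - 1\<close>, which makes the later
    inequality strict.\<close>
  have "UNIV \<subseteq> r ` S \<union> (\<lambda>s. - r s) ` (S - {0})"
  proof
    fix x :: 'a
    have "x = r (x\<^sup>2) \<or> x = - r (x\<^sup>2)"
      using r[of x] by (auto simp: power2_eq_iff)
    moreover have "x\<^sup>2 \<in> S" by (simp add: S_def)
    moreover have "x = r (x\<^sup>2)" if "x\<^sup>2 = 0" using that r[of x] by simp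
    ultimately show "x \<in> r ` S \<union> (\<lambda>s. - r s) ` (S - {0})" by blast
  qed
  then have "CARD('a) \<le> card (r ` S \<union> (\<lambda>s. - r s) ` (S - {0}))"
    by (intro card_mono) auto
  also have "\<dots> \<le> card (r ` S) + card ((\<lambda>s. - r s) ` (S - {0}))"
    by (rule card_Un_le)
  also have "\<dots> \<le> card S + card (S - {0})"
    by (intro add_mono card_image_le) auto
  also have "card (S - {0}) = card S - 1"
    by (rule card_Diff_singleton) (auto simp: S_def image_iff intro: exI[of _ 0])
  finally have "CARD('a) \<le> card S + (card S - 1)" .
  moreover have "0 < CARD('a)" by simp
  ultimately have q: "CARD('a) < card S + card S" by linarith
  define A where "A = (\<lambda>s. a * s) ` S"
  define B where "B = (\<lambda>s. c - b * s) ` S"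
  have "card A = card S" unfolding A_def
    by (rule card_image) (use assms in \<open>simp add: inj_on_def\<close>)
  moreover have "card B = card S" unfolding B_def
    by (rule card_image) (use assms in \<open>simp add: inj_on_def\<close>)
  moreover have "card (A \<union> B) \<le> CARD('a)" by (intro card_mono) auto
  ultimately have "A \<inter> B \<noteq> {}"
    using q card_Un_disjoint[of A B] by fastforce
  then obtain x y where "a * x\<^sup>2 = c - b * y\<^sup>2"
    by (auto simp: A_def B_def S_def)
  then show thesis by (intro that[of x y]) simp
qed

text \<open>Supplies a point of the conic from which it can be parametrized. In odd characteristic,
  completing the square twice reduces the claim to representing a value by a binary diagonal form.
  In characteristic 2 every element is a square, and the radical of the polar form provides a
  direction without mixed term.\<close>

lemma ternary_quadratic_form_isotropic:
  fixes Q :: "'a::{field,finite} ^ 3 \<Rightarrow> 'a"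
  assumes "quadratic_form Q"
  obtains v where "v \<noteq> 0" "Q v = 0"
proof -
  obtain a b c f g h where Q: "\<And>v. Q v =
     a * (v $ 1)\<^sup>2 + b * (v $ 2)\<^sup>2 + c * (v $ 3)\<^sup>2
       + f * v $ 2 * v $ 3 + g * v $ 3 * v $ 1 + h * v $ 1 * v $ 2"
    using assms unfolding quadratic_form_def by blast
  have "\<exists>x y z. (x \<noteq> 0 \<or> y \<noteq> 0 \<or> z \<noteq> 0) \<and> Q (vector [x, y, z]) = 0"
  proof (cases "a = 0")
    case True
    then have "Q (vector [1, 0, 0]) = 0" by (simp add: Q)
    then show ?thesis by (intro exI[of _ 1] exI[of _ 0]) simp
  next
    case a: False
    show ?thesis
    proof (cases "(2::'a) = 0")
      case two: True
      have double: "x + x = 0" for x :: 'a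
        using two by (metis mult_2 mult_zero_left)
      have "inj (\<lambda>x::'a. x\<^sup>2)"
      proof (rule injI)
        fix x y :: 'a assume "x\<^sup>2 = y\<^sup>2"
        then have "(x + y)\<^sup>2 = 0"
          by (simp only: power2_sum two double mult_zero_left add_0_right)
        then have "x + y = y + y" by (simp add: double)
        then show "x = y" by (simp only: add_right_cancel)
      qed
      then have surj: "surj (\<lambda>x::'a. x\<^sup>2)"
        by (rule finite_UNIV_inj_surj[OF finite])
      obtain y where y: "a = y\<^sup>2" using surj by (rule surjE)
      then have "y \<noteq> 0" using a by auto
      show ?thesis
      proof (cases "g = 0 \<and> h = 0")
        \<comment> \<open>Here the radical vector is a multiple of the first unit vector, so the
          witness of the other case could be zero. With \<open>h = 0\<close> the form on the first
          two coordinates is diagonal, and \<open>(x, y, 0)\<close> makes its two terms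
          equal.\<close>
        case True
        obtain x where x: "b = x\<^sup>2" using surj by (rule surjE)
        have "Q (vector [x, y, 0]) = 0"
          using True by (simp add: Q x y double mult.commute)
        then show ?thesis using \<open>y \<noteq> 0\<close> by blast
      next
        case False
        \<comment> \<open>\<open>(f, g, h)\<close> spans the radical of the (alternating) polar form.\<close>
        define n where "n = Q (vector [f, g, h])"
        obtain x where x: "n = x\<^sup>2" using surj by (rule surjE)
        have "Q (vector [x + y * f, y * g, y * h])
          = a * x\<^sup>2 + y\<^sup>2 * n + (a * x * y * f + a * x * y * f) + (x * y * g * h + x * y * g * h)"
          by (simp add: Q n_def power2_eq_square algebra_simps)
        also have "\<dots> = 0"
          by (simp add: double x flip: y)
        finally show ?thesis using \<open>y \<noteq> 0\<close> False by (metis mult_eq_0_iff)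
      qed
    next
      case two: False
      then have four: "(4::'a) \<noteq> 0"
        by (metis mult_eq_0_iff numeral_times_numeral semiring_norm(12,13) numeral_Bit0 mult_2)
      \<comment> \<open>With \<open>X = 2 a x + h y + g z\<close>, the form satisfies
        \<open>4 a Q = X^2 + p y^2 + 2 s y z + r z^2\<close>. Multiplying by \<open>p\<close> and
        completing the square once more gives \<open>Y = p y + s z\<close>; below,
        \<open>z = 1\<close>.\<close>
      define p where "p = 4 * a * b - h\<^sup>2"
      define r where "r = 4 * a * c - g\<^sup>2"
      define s where "s = 2 * a * f - g * h"
      show ?thesis
      proof (cases "p = 0")
        case True
        have "Q (vector [- h, 2 * a, 0]) = a * p"
          by (simp add: Q p_def power2_eq_square algebra_simps)
        then show ?thesis using True a two by (metis mult_eq_0_iff)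
      next
        case p: False
        obtain X Y where XY: "p * X\<^sup>2 + 1 * Y\<^sup>2 = s\<^sup>2 - p * r"
          using binary_diagonal_represents[OF p one_neq_zero] by metis
        define y where "y = (Y - s) / p"
        define x where "x = (X - h * y - g) / (2 * a)"
        have X: "X = 2 * a * x + h * y + g" using a two by (simp add: x_def)
        have Y: "Y = p * y + s" using p by (simp add: y_def)
        have "4 * a * p * Q (vector [x, y, 1]) = p * X\<^sup>2 + Y\<^sup>2 + p * r - s\<^sup>2"
          unfolding X Y by (simp add: Q p_def r_def s_def power2_eq_square algebra_simps)
        also have "\<dots> = 0" using XY by simp
        finally have "Q (vector [x, y, 1]) = 0" using a p four by simp
        then show ?thesis by (metis one_neq_zero)
      qed
    qed
  qed
  then obtain x y z where xyz: "x \<noteq> 0 \<or> y \<noteq> 0 \<or> z \<noteq> 0" "Q (vector [x, y, z]) = 0" by blast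
  show thesis
    by (rule that[OF _ xyz(2)]) (use xyz(1) in \<open>auto simp: vec_eq_iff forall_3\<close>)
qed

text \<open>Choose \<open>w\<close> with \<open>(v\<^sub>0, w)\<close> a hyperbolic pair and \<open>u\<close> orthogonal to both; in the basis
  \<open>(w, u, v\<^sub>0)\<close> the form is \<open>x z + d y\<^sup>2\<close>.\<close>

lemma nondegenerate_form_normal_form:
  fixes Q :: "'a::field ^ 3 \<Rightarrow> 'a"
  assumes "quadratic_form Q" and nondeg: "nondegenerate_form Q" and v0: "v0 \<noteq> 0" "Q v0 = 0"
  obtains m0 m1 m2 k d where "det3 m0 m1 m2 \<noteq> 0" "k \<noteq> 0" "m2 = k *s v0" "d \<noteq> 0"
    "\<And>x y z. Q (x *s m0 + y *s m1 + z *s m2) = d * (y\<^sup>2 - x * z)"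
proof -
  obtain a b c f g h where Q: "\<And>v. Q v =
     a * (v $ 1)\<^sup>2 + b * (v $ 2)\<^sup>2 + c * (v $ 3)\<^sup>2
       + f * v $ 2 * v $ 3 + g * v $ 3 * v $ 1 + h * v $ 1 * v $ 2"
    using assms unfolding quadratic_form_def by blast
  define P :: "'a ^ 3 \<Rightarrow> 'a ^ 3 \<Rightarrow> 'a" where "P v w = 2 * a * v$1 * w$1 + 2 * b * v$2 * w$2 + 2 * c * v$3 * w$3
    + f * (v$2 * w$3 + v$3 * w$2) + g * (v$3 * w$1 + v$1 * w$3) + h * (v$1 * w$2 + v$2 * w$1)" for v w
  have Q_add: "Q (v + w) = Q v + Q w + P v w" for v w
    by (simp add: Q P_def power2_eq_square algebra_simps)
  have Q_scale: "Q (x *s v) = x\<^sup>2 * Q v" for x v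
    by (simp add: Q power2_eq_square algebra_simps)
  have P_lin: "P (v + v') w = P v w + P v' w" "P w (v + v') = P w v + P w v'"
    "P (x *s v) w = x * P v w" "P w (x *s v) = x * P w v" for v v' w x
    by (simp_all add: P_def algebra_simps)
  have P_sym: "P v w = P w v" for v w by (simp add: P_def algebra_simps)
  have P_same: "P v v = 2 * Q v" for v by (simp add: P_def Q power2_eq_square algebra_simps)
  have nondeg': "v = 0" if "Q v = 0" "\<And>w. P v w = 0" for v
    using nondeg that unfolding nondegenerate_form_def by (simp add: Q_add)
  obtain w' where w': "P v0 w' \<noteq> 0" using nondeg'[of v0] v0 by blast
  define w1 where "w1 = (1 / P v0 w') *s w'"
  \<comment> \<open>Since \<open>P v0 w1 = 1\<close>, subtracting \<open>Q w1\<close> times the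
    isotropic vector \<open>v0\<close> cancels \<open>Q w1\<close> and leaves the pairing with
    \<open>v0\<close> unchanged.\<close>
  define w where "w = w1 + (- Q w1) *s v0"
  have "P v0 w1 = 1" using w' by (simp add: w1_def P_lin)
  then have Pw: "P v0 w = 1" and Qw: "Q w = 0"
    using v0 by (simp_all only: w_def P_lin P_same Q_add Q_scale P_sym[of w1 v0]) simp_all
  obtain y where y: "det3 w y v0 \<noteq> 0"
  proof -
    have "\<exists>y. det3 w y v0 \<noteq> 0"
    proof (rule ccontr)
      assume "\<nexists>y. det3 w y v0 \<noteq> 0"
      then have "det3 w (vector [1, 0, 0]) v0 = 0" "det3 w (vector [0, 1, 0]) v0 = 0"
        "det3 w (vector [0, 0, 1]) v0 = 0" by auto
      \<comment> \<open>All 2 by 2 minors vanish, so \<open>w\<close> and \<open>v0\<close> are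
        proportional. This contradicts \<open>P v0 w = 1\<close>, as
        \<open>P v0 v0 = 2 * Q v0 = 0\<close>.\<close>
      then have minors: "w$1 * v0$2 = w$2 * v0$1" "w$1 * v0$3 = w$3 * v0$1" "w$2 * v0$3 = w$3 * v0$2"
        by (simp_all add: det3_def)
      have "v0 $ i *s w = w $ i *s v0" for i
        using exhaust_3[of i] minors by (auto simp: vec_eq_iff forall_3 mult.commute)
      then have "v0 $ i * P v0 w = w $ i * P v0 v0" for i
        by (metis P_lin(4))
      then have "v0 $ i = 0" for i using v0 by (simp add: Pw P_same)
      then show False using v0 by (simp add: vec_eq_iff)
    qed
    then show thesis using that by blast
  qed
  define u where "u = y + (- P w y) *s v0 + (- P v0 y) *s w"
  have Pu: "P v0 u = 0" "P w u = 0"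
    using v0 Qw by (simp_all only: u_def P_lin P_same Pw P_sym[of w v0]) simp_all
  have det: "det3 w u v0 \<noteq> 0"
  proof -
    have "det3 w u v0 = det3 w y v0"
      unfolding u_def by (simp only: det3_add det3_scale det3_same) simp
    then show ?thesis using y by simp
  qed
  define d where "d = Q u"
  \<comment> \<open>If \<open>Q u\<close> were 0, then \<open>u\<close> would be orthogonal to the
    basis \<open>w\<close>, \<open>u\<close>, \<open>v0\<close> and hence a singular vector.\<close>
  have d: "d \<noteq> 0"
  proof
    assume "d = 0"
    have "P u x = 0" for x
      by (subst det3_combination[OF det, of x])
        (use Pu \<open>d = 0\<close> in \<open>simp add: P_lin P_sym[of u] P_same d_def\<close>)
    then have "u = 0" using \<open>d = 0\<close> by (intro nondeg') (simp_all add: d_def)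
    then show False using det by (simp add: det3_def)
  qed
  \<comment> \<open>In the basis \<open>w\<close>, \<open>u\<close>, \<open>v0\<close> the form is
    \<open>d y^2 + x z\<close>; replacing \<open>v0\<close> by \<open>- d\<close> times itself lets
    the factor \<open>d\<close> be taken out.\<close>
  show thesis
  proof (rule that[of w u "(- d) *s v0" "- d" d])
    show "det3 w u ((- d) *s v0) \<noteq> 0" using d det by (simp only: det3_scale) simp
    show "Q (x *s w + y *s u + z *s ((- d) *s v0)) = d * (y\<^sup>2 - x * z)" for x y z
      using v0 Pu Pw Qw
      by (simp only: Q_add Q_scale P_lin P_sym[of w v0] P_sym[of u v0] d_def) (simp add: algebra_simps)
  qed (use d in auto)
qed

section \<open>Coordinates for the Bruck-Bose representation\<close>

lemma vec_independentD:
  fixes B :: "('a::field ^ 'n) set"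
  assumes "vec.independent B" "(\<Sum>v\<in>B. c v *s v) = 0" "v \<in> B"
  shows "c v = 0"
  using assms vec.independent_explicit[of B] by simp

text \<open>Dimensions over \<open>'q\<close> are compared by counting below, since the subspaces in
  question arise from spaces over \<open>'c\<close> and come without a basis over
  \<open>'q\<close>.\<close>

lemma card_subspace:
  fixes U :: "('q::{field,finite} ^ 'n) set"
  assumes "vec.subspace U"
  shows "card U = CARD('q) ^ vec.dim U"
proof -
  obtain B where B: "B \<subseteq> U" "vec.independent B" "U \<subseteq> vec.span B" "card B = vec.dim U"
    using vec.basis_exists by blast
  have fin: "finite B" by simp
  have span: "vec.span B = U"
    using B assms by (metis subset_antisym vec.span_mono vec.span_eq_iff)
  define F where "F c = (\<Sum>b\<in>B. c b *s b)" for c :: "'q ^ 'n \<Rightarrow> 'q"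
  have "inj_on F (B \<rightarrow>\<^sub>E UNIV)"
  proof (rule inj_onI)
    fix c d assume cd: "c \<in> B \<rightarrow>\<^sub>E UNIV" "d \<in> B \<rightarrow>\<^sub>E UNIV" "F c = F d"
    then have "(\<Sum>b\<in>B. (c b - d b) *s b) = 0"
      by (simp add: F_def vec.scale_left_diff_distrib sum_subtractf)
    then have "c b - d b = 0" if "b \<in> B" for b
      using vec_independentD[OF B(2), of "\<lambda>b. c b - d b"] that by simp
    then show "c = d" using cd(1,2) by (intro PiE_ext) auto
  qed
  moreover have "F ` (B \<rightarrow>\<^sub>E UNIV) = U"
  proof -
    have "range F = U" using vec.span_finite[OF fin] by (simp add: F_def span)
    moreover have "F c = F (restrict c B)" for c by (simp add: F_def)
    ultimately show ?thesis by (auto simp: image_iff) (metis restrict_PiE_iff UNIV_I)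
  qed
  ultimately have "card U = card (B \<rightarrow>\<^sub>E (UNIV :: 'q set))"
    using card_image by force
  then show ?thesis by (simp add: card_funcsetE fin B(4))
qed

lemma pg_space_0: "pg_space 0 = {vec.span {w} | w. w \<noteq> 0}"
proof -
  have "\<exists>w. U = vec.span {w} \<and> w \<noteq> 0" if U: "vec.subspace U" "vec.dim U = 1" for U :: "('a ^ 'b) set"
  proof -
    obtain B where B: "B \<subseteq> U" "vec.independent B" "U \<subseteq> vec.span B" "card B = 1"
      using vec.basis_exists[of U] U(2) by metis
    then obtain w where "B = {w}" by (auto simp: card_1_singleton_iff)
    then show ?thesis
      using B U(1) vec.span_minimal[of "{w}" U] by auto
  qed
  then show ?thesis
    by (auto simp: pg_space_def)
qed

section \<open>Conjugate vectors, the trace, and coordinates from a regular spread\<close>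

context cubic_extension
begin

definition frv :: "'c ^ 'n \<Rightarrow> 'c ^ 'n" where "frv v = (\<chi> i. fr (v $ i))"

text \<open>The trace from \<open>'c\<close> to \<open>'q\<close>, taken in each coordinate; its
  values are fixed by \<open>frv\<close> and hence are lifts of vectors over
  \<open>'q\<close>.\<close>

definition tr_vec :: "'c ^ 'n \<Rightarrow> 'c ^ 'n" where "tr_vec v = v + frv v + frv (frv v)"

lemma power_vec_eq: "power_vec CARD('q) = frv" "power_vec (CARD('q)\<^sup>2) = (\<lambda>v. frv (frv v))"
  by (simp_all add: fun_eq_iff power_vec_def frv_def vec_eq_iff fr_fr) (simp add: fr_def)

lemma frv_lin: "frv (v + w) = frv v + frv w" "frv (a *s v) = fr a *s frv v"
  "frv (frv (frv v)) = v" "frv (lift_vec \<iota> u) = lift_vec \<iota> u" "frv 0 = 0"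
  by (simp_all add: frv_def vec_eq_iff fr_hom lift_vec_def)

lemma tr_vec_lin: "tr_vec (v + w) = tr_vec v + tr_vec w" "tr_vec 0 = 0"
  "tr_vec (\<iota> a *s v) = \<iota> a *s tr_vec v"
  by (simp_all add: tr_vec_def frv_lin vec.scale_right_distrib)

lemma lift_vec_lin: "lift_vec \<iota> (v + w) = lift_vec \<iota> v + lift_vec \<iota> w"
  "lift_vec \<iota> (a *s v) = \<iota> a *s lift_vec \<iota> v" "lift_vec \<iota> v = lift_vec \<iota> w \<longleftrightarrow> v = w"
  by (simp_all add: lift_vec_def vec_eq_iff emb_hom emb_inj)

lemma frv_fixed: "frv v = v \<longleftrightarrow> v \<in> range (lift_vec \<iota>)"
proof
  assume "frv v = v"
  then have "\<forall>i. \<exists>x. v $ i = \<iota> x"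
    using fr_fixed_iff by (auto simp: vec_eq_iff frv_def)
  then obtain u where "v $ i = \<iota> (u $ i)" for i by (auto simp: lambda_skolem)
  then have "v = lift_vec \<iota> u" by (simp add: vec_eq_iff lift_vec_def)
  then show "v \<in> range (lift_vec \<iota>)" by simp
qed (auto simp: frv_lin)

text \<open>The trace is a polynomial of degree \<open>q^2 < q^3\<close>, so it has a nonzero value
  \<open>t\<close>. As \<open>t\<close> is fixed by \<open>fr\<close>, scaling the argument by
  \<open>inverse t\<close> makes the trace 1.\<close>

lemma trace_one: obtains e :: 'c where "e + fr e + fr (fr e) = 1"
proof -
  define q where "q = CARD('q)"
  have q: "1 < q" unfolding q_def by (rule one_less_CARD)
  then have q2: "1 < q\<^sup>2" "q < q\<^sup>2" "q\<^sup>2 < q ^ 3"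
    using less_1_mult[OF q q] by (simp_all add: power2_eq_square power3_eq_cube)
  define p :: "'c poly" where "p = monom 1 (q\<^sup>2) + monom 1 q + monom 1 1"
  have "coeff p (q\<^sup>2) = 1" using q2 by (simp add: p_def)
  then have "p \<noteq> 0" by auto
  have "degree p \<le> q\<^sup>2" unfolding p_def using q2
    by (intro degree_add_le) (auto intro: order.trans[OF degree_monom_le])
  then have "card {x. poly p x = 0} \<noteq> CARD('c)"
    using card_poly_roots_bound[OF \<open>p \<noteq> 0\<close>] q2 by (simp add: card_ext flip: q_def)
  then have "{x. poly p x = 0} \<noteq> UNIV" by auto
  then obtain x where "poly p x \<noteq> 0" by auto
  define t where "t = x + fr x + fr (fr x)"
  have "poly p x = t"
    by (simp add: p_def poly_monom t_def fr_fr q_def) (simp add: fr_def)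
  then have t: "t \<noteq> 0" using \<open>poly p x \<noteq> 0\<close> by simp
  have frt: "fr t = t" by (simp add: t_def fr_hom)
  have "fr (inverse t) * t = inverse t * t"
    using fr_hom(4)[of "inverse t" t] t by (simp add: frt fr_hom)
  then have "fr (inverse t) = inverse t" using t by (simp add: field_simps)
  then have "inverse t * x + fr (inverse t * x) + fr (fr (inverse t * x)) = inverse t * t"
    by (simp add: fr_hom t_def distrib_left)
  then show thesis using t by (intro that[of "inverse t * x"]) simp
qed

text \<open>With \<open>e\<close> of trace 1, a conjugation-invariant \<open>v\<close> equals \<open>tr_vec (e *s v)\<close>, and the trace
  moves all conjugates of \<open>X\<close> back to \<open>X\<close>.\<close>

lemma lift_vec_in_conj_span:
  fixes X :: "('c ^ 'n) set"
  assumes X: "vec.subspace X"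
  shows "lift_vec \<iota> v \<in> conj_span CARD('q) X \<longleftrightarrow> (\<exists>x\<in>X. lift_vec \<iota> v = tr_vec x)"
proof
  assume v: "lift_vec \<iota> v \<in> conj_span CARD('q) X"
  \<comment> \<open>Quantifying over all multiples \<open>e *s s\<close> makes this set closed under
    scalars of \<open>'c\<close>, which the trace alone would not allow.\<close>
  let ?W = "{s. \<forall>e. \<exists>x\<in>X. tr_vec (e *s s) = tr_vec x}"
  have "vec.subspace ?W"
    unfolding vec.subspace_def
  proof (intro conjI ballI allI)
    show "0 \<in> ?W" using vec.subspace_0[OF X] by force
  next
    fix s t assume st: "s \<in> ?W" "t \<in> ?W"
    show "s + t \<in> ?W"
    proof (clarify)
      fix e
      obtain x y where "x \<in> X" "y \<in> X" "tr_vec (e *s s) = tr_vec x" "tr_vec (e *s t) = tr_vec y"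
        using st by blast
      then show "\<exists>x\<in>X. tr_vec (e *s (s + t)) = tr_vec x"
        by (intro bexI[of _ "x + y"])
          (simp_all add: vec.scale_right_distrib tr_vec_lin vec.subspace_add[OF X])
    qed
  next
    fix c s assume "s \<in> ?W"
    then show "c *s s \<in> ?W" by simp
  qed
  moreover have "X \<union> frv ` X \<union> (\<lambda>v. frv (frv v)) ` X \<subseteq> ?W"
  proof (intro Un_least subsetI CollectI allI)
    fix s e assume "s \<in> X"
    then show "\<exists>x\<in>X. tr_vec (e *s s) = tr_vec x" using vec.subspace_scale[OF X] by blast
  next
    fix s e assume "s \<in> frv ` X"
    then obtain x where x: "x \<in> X" "s = frv x" by blast
    \<comment> \<open>The trace is invariant under conjugation, and conjugating
      \<open>fr (fr e) *s x\<close> once gives \<open>e *s frv x\<close>.\<close>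
    have "tr_vec (e *s s) = tr_vec (fr (fr e) *s x)"
      by (simp add: x tr_vec_def frv_lin)
    then show "\<exists>x\<in>X. tr_vec (e *s s) = tr_vec x" using vec.subspace_scale[OF X] x by blast
  next
    fix s e assume "s \<in> (\<lambda>v. frv (frv v)) ` X"
    then obtain x where x: "x \<in> X" "s = frv (frv x)" by blast
    have "tr_vec (e *s s) = tr_vec (fr e *s x)"
      by (simp add: x tr_vec_def frv_lin)
    then show "\<exists>x\<in>X. tr_vec (e *s s) = tr_vec x" using vec.subspace_scale[OF X] x by blast
  qed
  ultimately have "conj_span CARD('q) X \<subseteq> ?W"
    unfolding conj_span_def power_vec_eq by (rule vec.span_minimal[rotated])
  moreover obtain e :: 'c where e: "e + fr e + fr (fr e) = 1" by (rule trace_one)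
  ultimately obtain x where x: "x \<in> X" "tr_vec (e *s lift_vec \<iota> v) = tr_vec x" using v by blast
  have "tr_vec (e *s lift_vec \<iota> v) = (e + fr e + fr (fr e)) *s lift_vec \<iota> v"
    by (simp add: tr_vec_def frv_lin vec.scale_left_distrib)
  then show "\<exists>x\<in>X. lift_vec \<iota> v = tr_vec x" using x e by (metis vec.scale_one)
next
  assume "\<exists>x\<in>X. lift_vec \<iota> v = tr_vec x"
  then obtain x where "x \<in> X" "lift_vec \<iota> v = x + frv x + frv (frv x)"
    by (auto simp: tr_vec_def)
  then show "lift_vec \<iota> v \<in> conj_span CARD('q) X"
    unfolding conj_span_def power_vec_eq
    by (simp only:) (intro vec.span_add vec.span_base; blast)
qed

end

text \<open>A point \<open>P\<close> of \<open>PG(2,q\<^sup>3)\<close> is represented by \<open>\<Lambda> -` P\<close>, where \<open>\<Lambda>\<close> identifies \<open>F\<^sub>q\<^sup>7\<close> with the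
  \<open>F\<^sub>q\<close>-space of the vectors over \<open>F\<^bsub>q\<^sup>3\<^esub>\<close> whose third coordinate lies in \<open>F\<^sub>q\<close>.\<close>

locale bruck_bose_coordinates = cubic_extension \<iota>
  for \<iota> :: "'q::{field,finite} \<Rightarrow> 'c::{field,finite}" +
  fixes \<Lambda> :: "'q ^ 7 \<Rightarrow> 'c ^ 3" and H :: "('q ^ 7) set" and S :: "('q ^ 7) set set"
  assumes \<Lambda>_add: "\<Lambda> (v + w) = \<Lambda> v + \<Lambda> w"
    and \<Lambda>_scale: "\<Lambda> (a *s v) = \<iota> a *s \<Lambda> v"
    and \<Lambda>_inj: "\<Lambda> v = \<Lambda> w \<Longrightarrow> v = w"
    and \<Lambda>_range: "range \<Lambda> = {w. w $ 3 \<in> range \<iota>}"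
    and H_eq: "H = {v. \<Lambda> v $ 3 = 0}"
    and S_eq: "S = {\<Lambda> -` vec.span {w} | w. w \<noteq> 0 \<and> w $ 3 = 0}"

text \<open>A basis \<open>u1\<close>, \<open>u2\<close> of \<open>g\<close> makes
  \<open>(x, y)\<close> an \<open>'c\<close>-coordinate pair for \<open>H\<close> through the trace
  of \<open>x *s u1 + y *s u2\<close>. Under this identification the spread plane of a point of
  \<open>g\<close> is the set of all \<open>'c\<close>-multiples of its coordinate pair. A vector
  \<open>p0\<close> off \<open>H\<close> supplies the last coordinate.\<close>

lemma (in cubic_extension) bruck_bose_coordinates_exist:
  fixes H :: "('q ^ 7) set"
  assumes H: "H \<in> pg_space 5" and S: "regular_2_spread \<iota> H S"
  obtains \<Lambda> where "bruck_bose_coordinates \<iota> \<Lambda> H S"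
proof -
  have subH: "vec.subspace H" and dimH: "vec.dim H = 6"
    using H by (auto simp: pg_space_def)
  obtain g where g: "g \<in> pg_space 1" "conj_span CARD('q) g = vec.span (lift_vec \<iota> ` H)"
    "S = {{v \<in> H. lift_vec \<iota> v \<in> conj_span CARD('q) X} | X. X \<in> points_in g}"
    using S unfolding regular_2_spread_def by blast
  have subg: "vec.subspace g" and dimg: "vec.dim g = 2" using g(1) by (auto simp: pg_space_def)
  obtain Bg where Bg: "Bg \<subseteq> g" "vec.independent Bg" "g \<subseteq> vec.span Bg" "card Bg = 2"
    using vec.basis_exists[of g] dimg by metis
  obtain u1 u2 where u: "Bg = {u1, u2}" "u1 \<noteq> u2" using Bg(4) by (auto simp: card_2_iff)
  have gE: "\<exists>x y. w = x *s u1 + y *s u2" if "w \<in> g" for w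
  proof -
    have "w \<in> vec.span {u1, u2}" using that Bg(3) u by auto
    then show ?thesis by (auto simp: vec.span_insert vec.span_singleton algebra_simps)
  qed
  have gI: "x *s u1 + y *s u2 \<in> g" for x y
    using Bg(1) u by (auto intro!: vec.subspace_add[OF subg] vec.subspace_scale[OF subg])
  have g0: "x = 0 \<and> y = 0" if "x *s u1 + y *s u2 = 0" for x y
  proof -
    have "(\<Sum>v\<in>Bg. (if v = u1 then x else y) *s v) = 0" using u that by simp
    then have "(if v = u1 then x else y) = 0" if "v \<in> Bg" for v
      using vec_independentD[OF Bg(2), of "\<lambda>v. if v = u1 then x else y"] that by blast
    then show ?thesis using u by (metis insertI1 insert_commute)
  qed
  define T where "T x y = tr_vec (x *s u1 + y *s u2)" for x y
  have "\<exists>v. lift_vec \<iota> v = T x y" for x y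
  proof -
    have "frv (T x y) = T x y" by (simp add: T_def tr_vec_def frv_lin)
    then show ?thesis unfolding frv_fixed by auto
  qed
  then obtain \<tau> where \<tau>: "lift_vec \<iota> (\<tau> x y) = T x y" for x y by metis
  \<comment> \<open>Only this inclusion is proved directly: a vector of \<open>H\<close> lies in the
    conjugate span of \<open>g\<close>, hence is a trace from \<open>g\<close>. As there are at most
    \<open>q^6\<close> such traces and \<open>H\<close> has \<open>q^6\<close> elements, equality
    follows.\<close>
  have H\<tau>: "H \<subseteq> (\<lambda>(x, y). \<tau> x y) ` UNIV"
  proof
    fix v assume "v \<in> H"
    then have "lift_vec \<iota> v \<in> conj_span CARD('q) g"
      unfolding g(2) by (intro vec.span_base) simp
    then obtain w where w: "w \<in> g" "lift_vec \<iota> v = tr_vec w"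
      using lift_vec_in_conj_span[OF subg] by blast
    obtain x y where "w = x *s u1 + y *s u2" using gE[OF w(1)] by blast
    then have "v = \<tau> x y" using w(2) by (simp add: T_def \<tau> flip: lift_vec_lin(3))
    then show "v \<in> (\<lambda>(x, y). \<tau> x y) ` UNIV" by force
  qed
  have "card ((\<lambda>(x, y). \<tau> x y) ` UNIV) \<le> card (UNIV :: ('c \<times> 'c) set)"
    by (rule card_image_le) simp
  also have "\<dots> = CARD('q) ^ 6"
    by (simp add: card_ext flip: UNIV_Times_UNIV power_add)
  also have "\<dots> = card H" by (simp add: card_subspace[OF subH] dimH)
  finally have H\<tau>_eq: "(\<lambda>(x, y). \<tau> x y) ` UNIV = H"
    using card_seteq[OF _ H\<tau>] by simp
  have "H \<noteq> UNIV"
    using dimH vec_dim_card[where 'a='q and 'n=7] by auto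
  then obtain p0 where p0: "p0 \<notin> H" by blast
  have "vec.dim (insert p0 H) = 7"
    using p0 subH dimH by (simp add: vec.dim_insert vec.span_eq_iff[THEN iffD2])
  then have "vec.span (insert p0 H) = UNIV"
    by (intro vec.dim_eq_full[THEN iffD1]) (simp add: card_cart_basis vec.dimension_def)
  then have dec: "\<exists>z. v - z *s p0 \<in> H" for v
    using vec.span_insert[of p0 H] subH by (auto simp: vec.span_eq_iff[THEN iffD2])
  define \<Theta> where "\<Theta> = (\<lambda>(x, y, z). \<tau> x y + z *s p0)"
  have "surj \<Theta>"
    unfolding surj_def
  proof
    fix v
    obtain z where "v - z *s p0 \<in> H" using dec by blast
    then obtain x y where "v - z *s p0 = \<tau> x y" using H\<tau> by auto
    then have "v = \<Theta> (x, y, z)" by (simp add: \<Theta>_def algebra_simps)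
    then show "\<exists>p. v = \<Theta> p" by blast
  qed
  \<comment> \<open>Domain and range both have \<open>q^7\<close> elements, so surjectivity gives
    injectivity.\<close>
  have "card (range \<Theta>) = card (UNIV :: ('c \<times> 'c \<times> 'q) set)"
  proof -
    have "card (range \<Theta>) = CARD('q) ^ 7"
      using card_subspace[OF vec.subspace_UNIV, where 'q='q and 'n=7] \<open>surj \<Theta>\<close> 
      by (simp add: vec_dim_card)
    then show ?thesis
      by (simp add: card_ext flip: UNIV_Times_UNIV power_add power_Suc2)
  qed
  then have "inj \<Theta>" by (intro eq_card_imp_inj_on) auto
  have \<tau>_lin: "\<tau> x y + \<tau> x' y' = \<tau> (x + x') (y + y')" "a *s \<tau> x y = \<tau> (\<iota> a * x) (\<iota> a * y)" for x y x' y' a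
  proof -
    have "T (x + x') (y + y') = T x y + T x' y'"
      by (simp add: T_def algebra_simps flip: tr_vec_lin)
    then show "\<tau> x y + \<tau> x' y' = \<tau> (x + x') (y + y')"
      by (simp add: \<tau> lift_vec_lin(1) flip: lift_vec_lin(3))
    have "T (\<iota> a * x) (\<iota> a * y) = \<iota> a *s T x y"
      by (simp add: T_def algebra_simps flip: tr_vec_lin)
    then show "a *s \<tau> x y = \<tau> (\<iota> a * x) (\<iota> a * y)"
      by (simp add: \<tau> lift_vec_lin(2) flip: lift_vec_lin(3))
  qed
  define \<Lambda> :: "'q ^ 7 \<Rightarrow> 'c ^ 3" where
    "\<Lambda> v = (case inv \<Theta> v of (x, y, z) \<Rightarrow> vector [x, y, \<iota> z])" for v
  have \<Lambda>: "\<Lambda> (\<Theta> (x, y, z)) = vector [x, y, \<iota> z]" for x y z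
    by (simp add: \<Lambda>_def inv_f_f[OF \<open>inj \<Theta>\<close>])
  have \<Theta>_cases: "\<exists>x y z. v = \<Theta> (x, y, z)" for v
    using \<open>surj \<Theta>\<close> by (metis surjD prod_cases3)
  have vec3_eq: "vector [a, b, c] = (vector [a', b', c'] :: 'c ^ 3) \<longleftrightarrow> a = a' \<and> b = b' \<and> c = c'"
    for a b c a' b' c' by (simp add: vec_eq_iff forall_3)
  have \<tau>H: "\<tau> x y \<in> H" for x y using H\<tau>_eq by auto
  have \<Theta>H: "\<Theta> (x, y, z) \<in> H \<longleftrightarrow> z = 0" for x y z
  proof
    assume "\<Theta> (x, y, z) \<in> H"
    then have "\<Theta> (x, y, z) - \<tau> x y \<in> H" using \<tau>H by (rule vec.subspace_diff[OF subH])
    then have "z *s p0 \<in> H" by (simp add: \<Theta>_def)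
    show "z = 0"
    proof (rule ccontr)
      assume "z \<noteq> 0"
      then have "p0 = inverse z *s (z *s p0)" by simp
      then show False using p0 vec.subspace_scale[OF subH \<open>z *s p0 \<in> H\<close>] by metis
    qed
  qed (simp add: \<Theta>_def \<tau>H)
  have point: "{v \<in> H. lift_vec \<iota> v \<in> conj_span CARD('q) (vec.span {x0 *s u1 + y0 *s u2})}
      = \<Lambda> -` vec.span {vector [x0, y0, 0]}" (is "?L = ?R") for x0 y0
  proof (intro set_eqI)
    fix v
    obtain x y z where v: "v = \<Theta> (x, y, z)" using \<Theta>_cases by blast
    have "v \<in> ?L \<longleftrightarrow> z = 0 \<and> (\<exists>k. lift_vec \<iota> v = T (k * x0) (k * y0))"
      unfolding mem_Collect_eq lift_vec_in_conj_span[OF vec.subspace_span]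
      by (auto simp: vec.span_singleton T_def v \<Theta>H vec.scale_right_distrib)
    also have "\<dots> \<longleftrightarrow> z = 0 \<and> (\<exists>k. v = \<Theta> (k * x0, k * y0, 0))"
      by (simp add: \<Theta>_def lift_vec_lin(3) flip: \<tau>)
    also have "\<dots> \<longleftrightarrow> z = 0 \<and> (\<exists>k. x = k * x0 \<and> y = k * y0 \<and> z = 0)"
      by (simp add: v inj_eq[OF \<open>inj \<Theta>\<close>])
    also have "\<dots> \<longleftrightarrow> v \<in> ?R"
      by (auto simp: v \<Lambda> vec.span_singleton vec_eq_iff forall_3 emb_eq_0)
    finally show "v \<in> ?L \<longleftrightarrow> v \<in> ?R" .
  qed
  have points_g: "points_in g = {vec.span {x0 *s u1 + y0 *s u2} | x0 y0. x0 \<noteq> 0 \<or> y0 \<noteq> 0}"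
  proof (intro set_eqI iffI)
    fix X assume "X \<in> points_in g"
    then obtain w where w: "w \<noteq> 0" "X = vec.span {w}" "X \<subseteq> g"
      by (auto simp: points_in_def pg_space_0)
    then have "w \<in> g" using vec.span_base[of w "{w}"] by auto
    then show "X \<in> {vec.span {x0 *s u1 + y0 *s u2} | x0 y0. x0 \<noteq> 0 \<or> y0 \<noteq> 0}"
      using gE[of w] w(1,2) by force
  next
    fix X assume "X \<in> {vec.span {x0 *s u1 + y0 *s u2} | x0 y0. x0 \<noteq> 0 \<or> y0 \<noteq> 0}"
    then obtain x0 y0 where X: "X = vec.span {x0 *s u1 + y0 *s u2}" "x0 \<noteq> 0 \<or> y0 \<noteq> 0" by blast
    then have "x0 *s u1 + y0 *s u2 \<noteq> 0" using g0 by blast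
    then show "X \<in> points_in g"
      using X gI vec.span_minimal[OF _ subg, of "{x0 *s u1 + y0 *s u2}"]
      by (auto simp: points_in_def pg_space_0)
  qed
  show thesis
  proof (rule that, unfold_locales)
    fix v w :: "'q ^ 7" and a
    obtain x y z where v: "v = \<Theta> (x, y, z)" using \<Theta>_cases by blast
    obtain x' y' z' where w: "w = \<Theta> (x', y', z')" using \<Theta>_cases by blast
    have "v + w = \<Theta> (x + x', y + y', z + z')"
      by (simp add: v w \<Theta>_def vec.scale_left_distrib flip: \<tau>_lin(1))
    then have "\<Lambda> (v + w) = vector [x + x', y + y', \<iota> (z + z')]"
      by (simp only: \<Lambda>)
    then show "\<Lambda> (v + w) = \<Lambda> v + \<Lambda> w"
      by (simp only: v w \<Lambda>) (simp add: vec_eq_iff forall_3 emb_hom)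
    have "a *s v = \<Theta> (\<iota> a * x, \<iota> a * y, a * z)"
      by (simp add: v \<Theta>_def vec.scale_right_distrib flip: \<tau>_lin(2))
    then have "\<Lambda> (a *s v) = vector [\<iota> a * x, \<iota> a * y, \<iota> (a * z)]"
      by (simp only: \<Lambda>)
    then show "\<Lambda> (a *s v) = \<iota> a *s \<Lambda> v"
      by (simp only: v \<Lambda>) (simp add: vec_eq_iff forall_3 emb_hom)
    show "v = w" if "\<Lambda> v = \<Lambda> w"
      using that by (simp add: v w \<Lambda> vec3_eq emb_inj)
  next
    show "range \<Lambda> = {w. w $ 3 \<in> range \<iota>}"
    proof (intro set_eqI iffI)
      fix w :: "'c ^ 3" assume "w \<in> {w. w $ 3 \<in> range \<iota>}"
      then obtain z where "w $ 3 = \<iota> z" by auto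
      then have "w = \<Lambda> (\<Theta> (w $ 1, w $ 2, z))" by (simp add: \<Lambda> vec_eq_iff forall_3)
      then show "w \<in> range \<Lambda>" by blast
    next
      fix w assume "w \<in> range \<Lambda>"
      then obtain v where "w = \<Lambda> v" by blast
      then show "w \<in> {w. w $ 3 \<in> range \<iota>}" using \<Theta>_cases[of v] by (auto simp: \<Lambda>)
    qed
  next
    have "v \<in> H \<longleftrightarrow> \<Lambda> v $ 3 = 0" for v
      using \<Theta>_cases[of v] by (auto simp: \<Lambda> \<Theta>H emb_eq_0)
    then show "H = {v. \<Lambda> v $ 3 = 0}" by blast
  next
    define F where "F X = {v \<in> H. lift_vec \<iota> v \<in> conj_span CARD('q) X}" for X
    have "S = F ` points_in g" unfolding g(3) F_def by auto
    also have "\<dots> = {F (vec.span {x0 *s u1 + y0 *s u2}) | x0 y0. x0 \<noteq> 0 \<or> y0 \<noteq> 0}"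
      unfolding points_g by blast
    also have "\<dots> = {\<Lambda> -` vec.span {vector [x0, y0, 0]} | x0 y0. x0 \<noteq> 0 \<or> y0 \<noteq> 0}"
      unfolding F_def point by (rule refl)
    also have "\<dots> = {\<Lambda> -` vec.span {w} | w. w \<noteq> 0 \<and> w $ 3 = 0}"
    proof -
      have "w = vector [w $ 1, w $ 2, 0] \<and> (w $ 1 \<noteq> 0 \<or> w $ 2 \<noteq> 0)"
        if "w \<noteq> 0" "w $ 3 = 0" for w :: "'c ^ 3"
        using that by (auto simp: vec_eq_iff forall_3)
      moreover have "vector [x0, y0, 0] \<noteq> (0 :: 'c ^ 3)" if "x0 \<noteq> 0 \<or> y0 \<noteq> 0" for x0 y0
        using that by (auto simp: vec_eq_iff forall_3)
      ultimately show ?thesis by (auto; metis vector_3(3))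
    qed
    finally show "S = {\<Lambda> -` vec.span {w} | w. w \<noteq> 0 \<and> w $ 3 = 0}" .
  qed
qed

section \<open>Points and lines of the representation in terms of vectors over
  \<open>'c\<close>\<close>

context bruck_bose_coordinates
begin

lemma \<Lambda>_0: "\<Lambda> 0 = 0"
  using \<Lambda>_scale[of 0 0] by (simp add: emb_hom)

lemma \<Lambda>_eq_0: "\<Lambda> v = 0 \<longleftrightarrow> v = 0"
  using \<Lambda>_inj[of v 0] by (auto simp: \<Lambda>_0)

lemma \<Lambda>_sum: "\<Lambda> (sum f A) = (\<Sum>x\<in>A. \<Lambda> (f x))"
  by (induction A rule: infinite_finite_induct) (simp_all add: \<Lambda>_0 \<Lambda>_add)

lemma \<Lambda>_vimage_subspace:
  assumes "vec.subspace U"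
  shows "vec.subspace (\<Lambda> -` U)"
  using vec.subspace_0[OF assms] vec.subspace_add[OF assms] vec.subspace_scale[OF assms]
  by (auto simp: vec.subspace_def \<Lambda>_0 \<Lambda>_add \<Lambda>_scale)

lemma \<Lambda>_3: obtains z where "\<Lambda> v $ 3 = \<iota> z"
  using \<Lambda>_range by blast

lemma \<Lambda>_surj: "w $ 3 \<in> range \<iota> \<Longrightarrow> \<exists>v. \<Lambda> v = w"
  using \<Lambda>_range by (metis (mono_tags, lifting) imageE mem_Collect_eq)

definition rep :: "'c ^ 3 \<Rightarrow> ('q ^ 7) set" where
  "rep w = \<Lambda> -` vec.span {w}"

lemma in_rep_iff: "v \<in> rep w \<longleftrightarrow> (\<exists>k. \<Lambda> v = k *s w)"
  by (auto simp: rep_def vec.span_singleton)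

lemma subspace_rep: "vec.subspace (rep w)"
  unfolding rep_def by (rule \<Lambda>_vimage_subspace) simp

lemma rep_scale:
  assumes "k \<noteq> 0"
  shows "rep (k *s w) = rep w"
proof -
  have "(\<exists>m. \<Lambda> v = m *s (k *s w)) \<longleftrightarrow> (\<exists>l. \<Lambda> v = l *s w)" for v
  proof
    assume "\<exists>l. \<Lambda> v = l *s w"
    then obtain l where "\<Lambda> v = l *s w" by blast
    then have "\<Lambda> v = (l / k) *s (k *s w)" using assms by simp
    then show "\<exists>m. \<Lambda> v = m *s (k *s w)" by blast
  qed auto
  then show ?thesis by (auto simp only: set_eq_iff in_rep_iff)
qed

lemma rep_nonzero:
  assumes "w \<noteq> 0"
  obtains v k where "v \<in> rep w" "v \<noteq> 0" "k \<noteq> 0" "\<Lambda> v = k *s w"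
proof -
  \<comment> \<open>Scaling makes the third coordinate 0 or 1, and both values lie in
    \<open>range \<iota>\<close>.\<close>
  have "\<exists>k. k \<noteq> 0 \<and> (k *s w) $ 3 \<in> range \<iota>"
  proof (cases "w $ 3 = 0")
    case True
    then show ?thesis using emb_hom(1) by (intro exI[of _ 1]) (auto simp: image_iff intro: exI[of _ 0])
  next
    case False
    then show ?thesis
      using emb_hom(2)
      by (intro exI[of _ "inverse (w $ 3)"]) (auto simp: image_iff intro: exI[of _ 1])
  qed
  then obtain k v where "k \<noteq> 0" "\<Lambda> v = k *s w" using \<Lambda>_surj by blast
  moreover from this have "v \<noteq> 0" using assms \<Lambda>_eq_0[of v] by auto
  ultimately show thesis using that by (auto simp: in_rep_iff)
qed

lemma rep_subset_rep:
  assumes "rep w \<subseteq> rep w'" "w \<noteq> 0"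
  obtains k where "k \<noteq> 0" "w = k *s w'"
proof -
  obtain v k where v: "v \<in> rep w" "v \<noteq> 0" "k \<noteq> 0" "\<Lambda> v = k *s w"
    by (rule rep_nonzero[OF assms(2)])
  then have "v \<in> rep w'" using assms(1) by blast
  then obtain l where l: "\<Lambda> v = l *s w'" unfolding in_rep_iff by blast
  have "w = inverse k *s (k *s w)" using v(3) by simp
  also have "\<dots> = inverse k *s (l *s w')" using v(4) l by simp
  also have "\<dots> = (inverse k * l) *s w'" by (rule vec.scale_scale)
  finally have "w = (inverse k * l) *s w'" .
  moreover from this have "inverse k * l \<noteq> 0" using assms(2) by auto
  ultimately show thesis using that by blast
qed

text \<open>Third coordinates lie in \<open>range \<iota>\<close>, and that of
  \<open>\<Lambda> v\<close> is nonzero, so a proportionality factor between two vectors in the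
  range of \<Lambda> comes from \<open>'q\<close>.\<close>

lemma rep_affine:
  assumes "\<Lambda> v $ 3 \<noteq> 0"
  shows "rep (\<Lambda> v) = vec.span {v}"
proof (intro set_eqI)
  fix u
  obtain c where c: "\<Lambda> v $ 3 = \<iota> c" by (rule \<Lambda>_3)
  then have "c \<noteq> 0" using assms by (auto simp: emb_hom)
  obtain d where d: "\<Lambda> u $ 3 = \<iota> d" by (rule \<Lambda>_3)
  have "u \<in> vec.span {v}" if "\<Lambda> u = k *s \<Lambda> v" for k
  proof -
    have "\<iota> (d / c) * \<iota> c = \<iota> d" using \<open>c \<noteq> 0\<close> by (simp flip: emb_hom(4))
    also have "\<dots> = k * \<iota> c" using that c d by (simp add: vec_eq_iff)
    finally have "k = \<iota> (d / c)" using \<open>c \<noteq> 0\<close> by (simp add: emb_eq_0)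
    then have "u = (d / c) *s v" using that by (intro \<Lambda>_inj) (simp add: \<Lambda>_scale)
    then show ?thesis by (auto simp: vec.span_singleton)
  qed
  moreover have "\<exists>k. \<Lambda> u = k *s \<Lambda> v" if "u \<in> vec.span {v}"
    using that by (auto simp: vec.span_singleton \<Lambda>_scale)
  ultimately show "u \<in> rep (\<Lambda> v) \<longleftrightarrow> u \<in> vec.span {v}"
    by (auto simp: in_rep_iff)
qed

lemma rep_in_S_iff:
  assumes "w \<noteq> 0"
  shows "rep w \<in> S \<longleftrightarrow> w $ 3 = 0"
proof
  assume "rep w \<in> S"
  then obtain w' where "w' $ 3 = 0" "rep w = rep w'" by (auto simp: S_eq rep_def)
  then show "w $ 3 = 0" using rep_subset_rep[of w w'] assms by fastforce
qed (use assms in \<open>auto simp: S_eq rep_def\<close>)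

lemma bb_points_eq: "bb_points H S = {rep w | w. w \<noteq> 0}"
proof (intro set_eqI iffI)
  fix X assume "X \<in> bb_points H S"
  then consider "X \<in> pg_space 0" "\<not> X \<subseteq> H" | "X \<in> S" by (auto simp: bb_points_def)
  then show "X \<in> {rep w | w. w \<noteq> 0}"
  proof cases
    case 1
    then obtain v where v: "X = vec.span {v}" "v \<noteq> 0" by (auto simp: pg_space_0)
    have "\<Lambda> v $ 3 \<noteq> 0" using 1 v by (auto simp: H_eq vec.span_singleton \<Lambda>_scale)
    then show ?thesis using rep_affine[of v] v \<Lambda>_eq_0[of v] by blast
  qed (auto simp: S_eq rep_def)
next
  fix X assume "X \<in> {rep w | w. w \<noteq> 0}"
  then obtain w where w: "X = rep w" "w \<noteq> 0" by blast
  show "X \<in> bb_points H S"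
  proof (cases "w $ 3 = 0")
    case True
    then show ?thesis using w rep_in_S_iff by (auto simp: bb_points_def)
  next
    case False
    obtain v k where v: "v \<in> rep w" "v \<noteq> 0" "k \<noteq> 0" "\<Lambda> v = k *s w" by (rule rep_nonzero[OF w(2)])
    then have "\<Lambda> v $ 3 \<noteq> 0" using False by simp
    moreover have "X = rep (\<Lambda> v)" using v w rep_scale by simp
    ultimately have "X = vec.span {v}" "v \<notin> H" using rep_affine by (auto simp: H_eq)
    then show ?thesis using v(2) vec.span_base[of v "{v}"] by (auto simp: bb_points_def pg_space_0)
  qed
qed

text \<open>The set is the 3-space joining a spread plane, which has \<open>q^3\<close> vectors, to
  an affine point. The third coordinate determines \<open>z\<close>, so sums do not
  coincide.\<close>

lemma card_cone:
  assumes "w0 \<noteq> 0" "w0 $ 3 = 0" "\<Lambda> p $ 3 \<noteq> 0"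
  shows "card ((\<lambda>(a, z). a + z *s p) ` (rep w0 \<times> UNIV)) = CARD('q) ^ 4"
proof -
  have "\<exists>v. \<Lambda> v = k *s w0" for k
  proof -
    have "(k *s w0) $ 3 \<in> range \<iota>"
      using assms(2) emb_hom(1) by (auto simp: image_iff intro: exI[of _ 0])
    then show ?thesis by (rule \<Lambda>_surj)
  qed
  then obtain f where f: "\<Lambda> (f k) = k *s w0" for k by metis
  have "bij_betw f UNIV (rep w0)"
  proof (rule bij_betw_imageI)
    show "inj f"
      by (rule injI) (metis f assms(1) vec.scale_right_imp_eq)
    show "range f = rep w0"
      using \<Lambda>_inj f by (auto simp: in_rep_iff) (metis rangeI)
  qed
  then have "card (rep w0) = CARD('q) ^ 3"
    using bij_betw_same_card card_ext by force
  moreover have "inj_on (\<lambda>(a, z). a + z *s p) (rep w0 \<times> UNIV)"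
  proof (rule inj_onI, clarify)
    fix a z b y assume ab: "a \<in> rep w0" "b \<in> rep w0" "a + z *s p = b + y *s p"
    then have "\<Lambda> (a + z *s p) $ 3 = \<Lambda> (b + y *s p) $ 3" by simp
    then have "\<iota> z = \<iota> y"
      using ab(1,2) assms(2,3) by (auto simp: \<Lambda>_add \<Lambda>_scale in_rep_iff)
    then show "a = b \<and> z = y" using ab(3) by (simp add: emb_inj)
  qed
  ultimately show ?thesis
    by (simp add: card_image card_cartesian_product power3_eq_cube power4_eq_xxxx mult_ac)
qed

text \<open>Lines of the representation correspond to 2-dimensional subspaces over
  \<open>'c\<close>. A 3-space through a spread plane is exhausted by the cone over an affine point,
  by counting, so its elements come from the span of \<open>w0\<close> and
  \<open>\<Lambda> p\<close>. Conversely, the preimage of a subspace not at infinity is such a cone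
  with \<open>q^4\<close> vectors.\<close>

lemma bb_collinear_iff:
  assumes nz: "w1 \<noteq> 0" "w2 \<noteq> 0" "w3 \<noteq> 0"
  shows "(\<exists>m\<in>bb_lines H S. rep w1 \<in> m \<and> rep w2 \<in> m \<and> rep w3 \<in> m) \<longleftrightarrow> det3 w1 w2 w3 = 0"
proof
  assume "\<exists>m\<in>bb_lines H S. rep w1 \<in> m \<and> rep w2 \<in> m \<and> rep w3 \<in> m"
  then obtain m where m: "m \<in> bb_lines H S" "rep w1 \<in> m" "rep w2 \<in> m" "rep w3 \<in> m" by blast
  then consider "m = S" | T \<pi> where "m = {P \<in> bb_points H S. P \<subseteq> T}" "T \<in> pg_space 3"
    "\<not> T \<subseteq> H" "\<pi> \<in> S" "\<pi> \<subseteq> T"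
    unfolding bb_lines_def by blast
  then show "det3 w1 w2 w3 = 0"
  proof cases
    case 1
    then have "w1 $ 3 = 0" "w2 $ 3 = 0" "w3 $ 3 = 0" using m nz rep_in_S_iff by auto
    then show ?thesis by (simp add: det3_def)
  next
    case 2
    obtain w0 where w0: "\<pi> = rep w0" "w0 \<noteq> 0" "w0 $ 3 = 0" using 2(4) by (auto simp: S_eq rep_def)
    obtain p where p: "p \<in> T" "\<Lambda> p $ 3 \<noteq> 0" using 2(3) by (auto simp: H_eq)
    have subT: "vec.subspace T" and dimT: "vec.dim T = 4" using 2(2) by (auto simp: pg_space_def)
    have "(\<lambda>(a, z). a + z *s p) ` (rep w0 \<times> UNIV) \<subseteq> T"
      using p(1) 2(5) w0(1) by (auto intro!: vec.subspace_add[OF subT] vec.subspace_scale[OF subT])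
    then have T: "(\<lambda>(a, z). a + z *s p) ` (rep w0 \<times> UNIV) = T"
      by (intro card_seteq) (simp_all add: card_cone[OF w0(2,3) p(2)] card_subspace[OF subT] dimT)
    \<comment> \<open>The summand \<open>0 *s 0\<close> only brings the combination into the
      three-term form required by \<open>det3_linear_combination\<close>; the third coefficients
      then form a zero column.\<close>
    have *: "\<exists>a b. w = a *s w0 + b *s \<Lambda> p + 0 *s 0" if w: "rep w \<in> m" "w \<noteq> 0" for w
    proof -
      obtain v k where v: "v \<in> rep w" "v \<noteq> 0" "k \<noteq> 0" "\<Lambda> v = k *s w" by (rule rep_nonzero[OF w(2)])
      have "v \<in> T" using v(1) w(1) 2(1) by auto
      then obtain u z where "u \<in> rep w0" "v = u + z *s p" using T by auto
      then obtain l where "\<Lambda> v = l *s w0 + \<iota> z *s \<Lambda> p" by (auto simp: in_rep_iff \<Lambda>_add \<Lambda>_scale)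
      then have "k *s w = l *s w0 + \<iota> z *s \<Lambda> p" using v(4) by simp
      then have "inverse k *s (k *s w) = inverse k *s (l *s w0 + \<iota> z *s \<Lambda> p)" by simp
      then have "w = (inverse k * l) *s w0 + (inverse k * \<iota> z) *s \<Lambda> p + 0 *s 0"
        using v(3) by (simp add: vec.scale_right_distrib)
      then show ?thesis by blast
    qed
    obtain a1 b1 where 1: "w1 = a1 *s w0 + b1 *s \<Lambda> p + 0 *s 0" using *[OF m(2) nz(1)] by blast
    obtain a2 b2 where 2: "w2 = a2 *s w0 + b2 *s \<Lambda> p + 0 *s 0" using *[OF m(3) nz(2)] by blast
    obtain a3 b3 where 3: "w3 = a3 *s w0 + b3 *s \<Lambda> p + 0 *s 0" using *[OF m(4) nz(3)] by blast
    show ?thesis unfolding 1 2 3 det3_linear_combination by (simp add: det3_def)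
  qed
next
  assume "det3 w1 w2 w3 = 0"
  then obtain U where U: "U \<in> pg_space 1" "w1 \<in> U" "w2 \<in> U" "w3 \<in> U"
    unfolding det3_eq_0_iff by blast
  have subU: "vec.subspace U" and dimU: "vec.dim U = 2" using U(1) by (auto simp: pg_space_def)
  show "\<exists>m\<in>bb_lines H S. rep w1 \<in> m \<and> rep w2 \<in> m \<and> rep w3 \<in> m"
  proof (cases "\<forall>w\<in>U. w $ 3 = 0")
    case True
    then show ?thesis
      using U nz rep_in_S_iff by (intro bexI[of _ S]) (auto simp: bb_lines_def)
  next
    case False
    then obtain x where x: "x \<in> U" "x $ 3 \<noteq> 0" by blast
    have "(inverse (x $ 3) *s x) $ 3 \<in> range \<iota>"
      using x(2) emb_hom(2) by (auto simp: image_iff intro: exI[of _ 1])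
    then obtain p where p: "\<Lambda> p = inverse (x $ 3) *s x" using \<Lambda>_surj by blast
    have p3: "\<Lambda> p $ 3 = 1" using x(2) by (simp add: p)
    have pU: "\<Lambda> p \<in> U" using x(1) by (simp add: p vec.subspace_scale[OF subU])
    have "\<exists>y\<in>U. y \<notin> vec.span {\<Lambda> p}"
    proof (rule ccontr)
      assume "\<not> (\<exists>y\<in>U. y \<notin> vec.span {\<Lambda> p})"
      then have "vec.dim U \<le> vec.dim {\<Lambda> p}" by (intro vec.dim_mono) auto
      then show False using dimU by (simp split: if_splits)
    qed
    then obtain y where y: "y \<in> U" "y \<notin> vec.span {\<Lambda> p}" by blast
    \<comment> \<open>Removing the third coordinate of \<open>y\<close> gives the point of
      \<open>U\<close> at infinity, whose spread plane lies in the 3-space.\<close>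
    define w0 where "w0 = y - y $ 3 *s \<Lambda> p"
    have w0U: "w0 \<in> U" unfolding w0_def
      by (intro vec.subspace_diff[OF subU] vec.subspace_scale[OF subU] y pU)
    have w03: "w0 $ 3 = 0" by (simp add: w0_def p3)
    have "y = w0 + y $ 3 *s \<Lambda> p" by (simp add: w0_def)
    then have w0_notin: "w0 \<notin> vec.span {\<Lambda> p}"
      using y(2) by (metis vec.span_add vec.span_scale vec.span_base insertI1)
    then have w0: "w0 \<noteq> 0" using vec.span_zero by metis
    have "vec.dim {w0, \<Lambda> p} = 2"
      using w0_notin p3 by (auto simp: vec.dim_insert)
    then have "vec.span {w0, \<Lambda> p} = U"
      by (intro vec.subspace_dim_equal) (simp_all add: subU dimU w0U pU vec.span_minimal)
    then have U_eq: "U = {a *s w0 + b *s \<Lambda> p | a b. True}"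
      by (auto simp: vec.span_insert vec.span_singleton algebra_simps)
    define T where "T = \<Lambda> -` U"
    have subT: "vec.subspace T" unfolding T_def by (rule \<Lambda>_vimage_subspace[OF subU])
    have "T = (\<lambda>(a, z). a + z *s p) ` (rep w0 \<times> UNIV)"
    proof (intro set_eqI iffI)
      fix v assume "v \<in> T"
      then obtain a b where ab: "\<Lambda> v = a *s w0 + b *s \<Lambda> p" by (auto simp: T_def U_eq)
      obtain z where "\<Lambda> v $ 3 = \<iota> z" by (rule \<Lambda>_3)
      then have "b = \<iota> z" using ab w03 p3 by simp
      then have "\<Lambda> (v - z *s p) = a *s w0"
        using ab \<Lambda>_add[of "v - z *s p" "z *s p"] by (simp add: \<Lambda>_scale)
      then have "v - z *s p \<in> rep w0" by (auto simp: in_rep_iff)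
      then show "v \<in> (\<lambda>(a, z). a + z *s p) ` (rep w0 \<times> UNIV)"
        by (intro image_eqI[of _ _ "(v - z *s p, z)"]) auto
    next
      fix v assume "v \<in> (\<lambda>(a, z). a + z *s p) ` (rep w0 \<times> UNIV)"
      then obtain a b where ab: "v = a + b *s p" "a \<in> rep w0" by auto
      then obtain k where "\<Lambda> a = k *s w0" by (auto simp: in_rep_iff)
      then have "\<Lambda> v = k *s w0 + \<iota> b *s \<Lambda> p" by (simp add: ab \<Lambda>_add \<Lambda>_scale)
      then show "v \<in> T" unfolding T_def U_eq vimage_def mem_Collect_eq by blast
    qed
    then have "card T = CARD('q) ^ 4" using card_cone[OF w0 w03, of p] p3 by simp
    moreover have "1 < CARD('q)" by (rule one_less_CARD)
    ultimately have "vec.dim T = 4"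
      using card_subspace[OF subT] power_inject_exp[of "CARD('q)" "vec.dim T" 4] by simp
    then have T: "T \<in> pg_space 3" using subT by (simp add: pg_space_def)
    have sub: "rep w \<subseteq> T" if "w \<in> U" for w
      using vec.subspace_scale[OF subU that] by (auto simp: T_def in_rep_iff)
    have "p \<in> T" "p \<notin> H" using pU p3 by (auto simp: T_def H_eq)
    moreover have "rep w0 \<in> S" using rep_in_S_iff w0 w03 by blast
    ultimately have "{P \<in> bb_points H S. P \<subseteq> T} \<in> bb_lines H S"
      using T sub[OF w0U] unfolding bb_lines_def by blast
    then show ?thesis
      using U nz sub by (intro bexI[of _ "{P \<in> bb_points H S. P \<subseteq> T}"]) (auto simp: bb_points_eq)
  qed
qed

end

section \<open>Normal rational curves\<close>

text \<open>Independence is required of the indexed family, which also yields injectivity: a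
  repeated vector is a nontrivial relation.\<close>

lemma normal_rational_curveI:
  fixes e :: "nat \<Rightarrow> 'a::field ^ 'n"
  assumes "\<And>w. (\<Sum>i\<le>r. w i *s e i) = 0 \<Longrightarrow> \<forall>i\<le>r. w i = 0"
  shows "normal_rational_curve r ({vec.span {\<Sum>i\<le>r. \<theta> ^ i *s e i} | \<theta>. True} \<union> {vec.span {e r}})"
proof -
  have inj: "inj_on e {..r}"
  proof (rule inj_onI, rule ccontr)
    fix i j assume ij: "i \<in> {..r}" "j \<in> {..r}" "e i = e j" "i \<noteq> j"
    define w :: "nat \<Rightarrow> 'a" where "w l = (if l = i then 1 else 0) - (if l = j then 1 else 0)" for l
    have "(\<Sum>l\<le>r. w l *s e l) = (\<Sum>l\<le>r. (if l = i then e l else 0) - (if l = j then e l else 0))"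
      by (rule sum.cong) (auto simp: w_def)
    also have "\<dots> = 0" using ij by (simp add: sum_subtractf)
    finally have "w i = 0" using assms ij(1) by blast
    then show False using ij(4) by (simp add: w_def)
  qed
  have "vec.independent (e ` {..r})"
  proof (subst vec.independent_explicit, intro conjI allI impI)
    fix c assume "(\<Sum>v\<in>e ` {..r}. c v *s v) = 0"
    then have "(\<Sum>i\<le>r. c (e i) *s e i) = 0"
      by (simp add: sum.reindex[OF inj])
    from assms[OF this] show "\<forall>v\<in>e ` {..r}. c v = 0" by auto
  qed simp
  moreover have "coord_point e r (\<lambda>i. if i = r then 1 else 0) = vec.span {e r}"
  proof -
    have "(\<Sum>i\<le>r. (if i = r then 1 else 0) *s e i) = (\<Sum>i\<le>r. if i = r then e i else 0)"
      by (rule sum.cong) auto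
    then show ?thesis by (simp add: coord_point_def)
  qed
  ultimately show ?thesis
    unfolding normal_rational_curve_def using inj
    by (intro exI[of _ e]) (auto simp: coord_point_def)
qed

context cubic_extension
begin

lemma map_poly_fr_mult: "map_poly fr (p * q) = map_poly fr p * map_poly fr q"
  by (rule poly_eqI) (simp add: coeff_map_poly coeff_mult fr_hom fr_sum)

lemma map_poly_fr3: "map_poly fr (map_poly fr (map_poly fr p)) = p"
  by (rule poly_eqI) (simp add: coeff_map_poly fr_hom)

lemma poly_map_poly_fr: "poly (map_poly fr p) (fr x) = fr (poly p x)"
  by (induction p) (simp_all add: map_poly_pCons fr_hom)

text \<open>The cross product of a vector with its conjugate spans the set of vectors orthogonal to
  both; it does not vanish, since otherwise the kernel over \<open>'q\<close> would be two-dimensional.\<close>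

lemma orthogonal_to_conjugates:
  fixes x y z :: 'q and c0 c1 c2 p0 p1 p2 :: 'c
  assumes ker0: "\<iota> x * c0 + \<iota> y * c1 + \<iota> z * c2 = 0"
    and ker: "\<And>u1 u2 u3. \<iota> u1 * c0 + \<iota> u2 * c1 + \<iota> u3 * c2 = 0 \<Longrightarrow>
      \<exists>k. u1 = k * x \<and> u2 = k * y \<and> u3 = k * z"
    and p: "c0 * p0 + c1 * p1 + c2 * p2 = 0" "fr c0 * p0 + fr c1 * p1 + fr c2 * p2 = 0"
  shows "\<iota> x * p1 = \<iota> y * p0" "\<iota> y * p2 = \<iota> z * p1" "\<iota> x * p2 = \<iota> z * p0"
proof -
  define n0 where "n0 = c1 * fr c2 - c2 * fr c1"
  define n1 where "n1 = c2 * fr c0 - c0 * fr c2"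
  define n2 where "n2 = c0 * fr c1 - c1 * fr c0"
  \<comment> \<open>The expansion of a vector triple product: a vector orthogonal to both factors of
    a cross product is parallel to that product.\<close>
  have orth: "a * n1 = b * n0 \<and> b * n2 = c * n1 \<and> a * n2 = c * n0"
    if "c0 * a + c1 * b + c2 * c = 0" "fr c0 * a + fr c1 * b + fr c2 * c = 0" for a b c
  proof -
    have "a * n1 - b * n0 = c2 * (fr c0 * a + fr c1 * b + fr c2 * c) - fr c2 * (c0 * a + c1 * b + c2 * c)"
      "b * n2 - c * n1 = c0 * (fr c0 * a + fr c1 * b + fr c2 * c) - fr c0 * (c0 * a + c1 * b + c2 * c)"
      "c * n0 - a * n2 = c1 * (fr c0 * a + fr c1 * b + fr c2 * c) - fr c1 * (c0 * a + c1 * b + c2 * c)"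
      by (simp_all add: n0_def n1_def n2_def algebra_simps)
    then show ?thesis using that by simp
  qed
  \<comment> \<open>The quotient \<open>b / a\<close> is fixed by conjugation, hence comes from
    \<open>'q\<close>.\<close>
  have ratio: "\<exists>k. b = a * \<iota> k" if "a \<noteq> 0" "a * fr b = b * fr a" for a b
  proof -
    have "fr (b / a) * fr a = fr b" using that(1) by (simp flip: fr_hom(4))
    then have "a * fr (b / a) * fr a = b * fr a"
      using that(2) by (simp only: mult.assoc)
    then have "fr (b / a) = b / a"
      using that(1) fr_eq_0[of a] by (simp add: field_simps)
    then obtain k where "b / a = \<iota> k" unfolding fr_fixed_iff by blast
    then show ?thesis using that(1) by (intro exI[of _ k]) (simp add: field_simps)
  qed
  have "n0 \<noteq> 0 \<or> n1 \<noteq> 0 \<or> n2 \<noteq> 0"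
  proof (rule ccontr)
    assume "\<not> (n0 \<noteq> 0 \<or> n1 \<noteq> 0 \<or> n2 \<noteq> 0)"
    then have n: "c1 * fr c2 = c2 * fr c1" "c2 * fr c0 = c0 * fr c2" "c0 * fr c1 = c1 * fr c0"
      by (simp_all add: n0_def n1_def n2_def)
    consider "c0 \<noteq> 0" | "c1 \<noteq> 0" | "c2 \<noteq> 0" | "c0 = 0" "c1 = 0" "c2 = 0" by blast
    then show False
    proof cases
      case 1
      \<comment> \<open>All coefficients being \<open>'q\<close>-multiples of one of them, there are
        two independent relations over \<open>'q\<close>, while \<open>ker\<close> allows only one
        up to scalars.\<close>
      obtain k l where kl: "c1 = c0 * \<iota> k" "c2 = c0 * \<iota> l" using ratio[OF 1] n by metis
      show False
        using ker[of "- k" 1 0] ker[of "- l" 0 1] by (auto simp: kl emb_hom)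
    next
      case 2
      obtain k l where kl: "c0 = c1 * \<iota> k" "c2 = c1 * \<iota> l" using ratio[OF 2] n by metis
      show False
        using ker[of 1 "- k" 0] ker[of 0 "- l" 1] by (auto simp: kl emb_hom)
    next
      case 3
      obtain k l where kl: "c0 = c2 * \<iota> k" "c1 = c2 * \<iota> l" using ratio[OF 3] n by metis
      show False
        using ker[of 1 0 "- k"] ker[of 0 1 "- l"] by (auto simp: kl emb_hom)
    next
      case 4
      show False using ker[of 1 0 0] ker[of 0 1 0] by (auto simp: 4)
    qed
  qed
  then have parallel: "\<exists>m. a = m * n0 \<and> b = m * n1 \<and> c = m * n2"
    if "a * n1 = b * n0 \<and> b * n2 = c * n1 \<and> a * n2 = c * n0" for a b c
  proof (elim disjE)
    assume "n0 \<noteq> 0"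
    then show ?thesis using that by (intro exI[of _ "a / n0"]) (simp add: field_simps)
  next
    assume "n1 \<noteq> 0"
    then show ?thesis using that by (intro exI[of _ "b / n1"]) (simp add: field_simps)
  next
    assume "n2 \<noteq> 0"
    then show ?thesis using that by (intro exI[of _ "c / n2"]) (simp add: field_simps)
  qed
  have "fr (\<iota> x * c0 + \<iota> y * c1 + \<iota> z * c2) = 0" using ker0 by (simp add: fr_hom)
  then have "fr c0 * \<iota> x + fr c1 * \<iota> y + fr c2 * \<iota> z = 0" by (simp add: fr_hom mult.commute)
  moreover have "c0 * \<iota> x + c1 * \<iota> y + c2 * \<iota> z = 0" using ker0 by (simp add: mult.commute)
  ultimately obtain k where k: "\<iota> x = k * n0" "\<iota> y = k * n1" "\<iota> z = k * n2"
    using parallel[OF orth[of "\<iota> x" "\<iota> y" "\<iota> z"]] by blast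
  obtain l where l: "p0 = l * n0" "p1 = l * n1" "p2 = l * n2"
    using parallel[OF orth[OF p]] by blast
  show "\<iota> x * p1 = \<iota> y * p0" "\<iota> y * p2 = \<iota> z * p1" "\<iota> x * p2 = \<iota> z * p0"
    by (simp_all add: k l)
qed

end

text \<open>The hypothesis says that each window \<open>(u j, u (j+1), u (j+2))\<close> is parallel
  to \<open>(x, y, z)\<close>. If \<open>k\<close> and \<open>l\<close> are the factors of two
  consecutive windows, their overlap gives \<open>k y = l x\<close> and \<open>k z = l y\<close>, so
  \<open>k (y^2 - x z) = 0\<close>, and likewise for \<open>l\<close>. The proof works with the 2 by
  2 minors instead of the factors; two windows are needed, hence \<open>1 \<le> n\<close>.\<close>

lemma recurrence_trivial:
  fixes x y z :: "'a::field" and u :: "nat \<Rightarrow> 'a"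
  assumes "\<And>j. j \<le> n \<Longrightarrow> x * u (j + 1) = y * u j \<and> y * u (j + 2) = z * u (j + 1) \<and> x * u (j + 2) = z * u j"
    and "y\<^sup>2 \<noteq> x * z" "1 \<le> n" "j \<le> n + 2"
  shows "u j = 0"
proof -
  have nz: "y * y - x * z \<noteq> 0" using assms(2) by (simp add: power2_eq_square)
  have r: "y * u j - x * u (j + 1) = 0" "y * u (j + 2) - z * u (j + 1) = 0" "z * u j - x * u (j + 2) = 0"
    if "j \<le> n" for j using assms(1)[OF that] by auto
  have low: "u j = 0" if "j < n" for j
  proof -
    have "(y * y - x * z) * u j = y * (y * u j - x * u (j + 1)) + x * (y * u (j + 1) - x * u (j + 1 + 1))
      - x * (z * u j - x * u (j + 2))" by (simp add: algebra_simps)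
    then show ?thesis using nz r(1)[of j] r(1)[of "j + 1"] r(3)[of j] that by simp
  qed
  have mid: "u (j + 1) = 0" if "j < n" for j
  proof -
    have "(y * y - x * z) * u (j + 1) =
        y * (y * u (j + 1) - x * u (j + 1 + 1)) + z * (y * u j - x * u (j + 1))
      - y * (z * u j - x * u (j + 2))" by (simp add: algebra_simps)
    then show ?thesis using nz r(1)[of j] r(1)[of "j + 1"] r(3)[of j] that by simp
  qed
  have high: "u (j + 2) = 0" if "1 \<le> j" "j \<le> n" for j
  proof -
    have "(y * y - x * z) * u (j + 2) =
        y * (y * u (j + 2) - z * u (j + 1)) + z * (y * u (j - 1 + 2) - z * u (j - 1 + 1))
      + z * (z * u j - x * u (j + 2))" using that by (simp add: algebra_simps)
    then show ?thesis using nz r(2)[of j] r(2)[of "j - 1"] r(3)[of j] that by simp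
  qed
  \<comment> \<open>For \<open>n = 1\<close> this index is reached neither by \<open>mid\<close> nor
    by \<open>high\<close>.\<close>
  have "u (Suc n) = 0"
  proof (cases "n = 1")
    case True
    have "(y * y - x * z) * u 2 = y * (y * u (0 + 2) - z * u (0 + 1)) + z * (y * u (0 + 1) - x * u (1 + 1))"
      by (simp add: algebra_simps numeral_2_eq_2)
    then show ?thesis using nz r(2)[of 0] r(1)[of 1] True by (simp add: numeral_2_eq_2)
  next
    case False
    then show ?thesis using high[of "n - 1"] assms(3) by simp
  qed
  then show ?thesis
    using low[of j] mid[of "n - 1"] high[of n] assms(3,4)
    by (cases "j < n"; cases "j = n"; cases "j = Suc n"; cases "j = Suc (Suc n)") auto
qed

section \<open>Functionals on polynomials and cancellation of conjugate factors\<close>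

context cubic_extension
begin

text \<open>Turns a relation \<open>w\<close> among coefficient vectors into a functional on
  polynomials. The weights are taken in \<open>'q\<close> so that it commutes with conjugation of
  coefficients.\<close>

definition functional :: "nat \<Rightarrow> (nat \<Rightarrow> 'q) \<Rightarrow> 'c poly \<Rightarrow> 'c" where
  "functional r w p = (\<Sum>i\<le>r. \<iota> (w i) * coeff p i)"

lemma functional_lin:
  "functional r w (p + q) = functional r w p + functional r w q"
  "functional r w (smult a p) = a * functional r w p"
  by (simp_all add: functional_def distrib_left sum.distrib sum_distrib_left mult_ac)

lemma fr_functional: "fr (functional r w p) = functional r w (map_poly fr p)"
  by (simp add: functional_def fr_sum fr_hom coeff_map_poly)

lemma functional_monom: "j \<le> r \<Longrightarrow> functional r w (monom 1 j) = \<iota> (w j)"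
  by (simp add: functional_def if_distrib cong: if_cong)

lemma functional_quadratic:
  "functional r w (monom 1 j * ([:a, b, c:] * p)) = a * functional r w (monom 1 j * p)
    + b * functional r w (monom 1 (j + 1) * p) + c * functional r w (monom 1 (j + 2) * p)"
proof -
  have "[:a, b, c:] = smult a (monom 1 0) + smult b (monom 1 1) + smult c (monom 1 2)"
    by (simp add: monom_0 monom_Suc numeral_2_eq_2)
  then have "monom 1 j * ([:a, b, c:] * p) = smult a (monom 1 j * p) + smult b (monom 1 (j + 1) * p)
      + smult c (monom 1 (j + 2) * p)"
    by (simp add: distrib_left distrib_right mult_monom flip: mult.assoc)
  then show ?thesis by (simp only: functional_lin)
qed

lemma map_poly_fr_monom: "map_poly fr (monom 1 j) = monom 1 j"
  by (rule poly_eqI) (simp add: coeff_map_poly fr_hom)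

text \<open>The point \<open>(x, y, z)\<close> is the one on the line at infinity. It lies off the conic
  \<open>y\<^sup>2 = x z\<close> if \<open>m = 2\<close>, and is the point \<open>(0, 0, 1)\<close> of the conic if \<open>m = 1\<close>.\<close>

lemma functional_trivial:
  fixes x y z :: 'q and c0 c1 c2 :: 'c
  defines "c \<equiv> [:c0, c1, c2:]"
  assumes ker0: "\<iota> x * c0 + \<iota> y * c1 + \<iota> z * c2 = 0"
    and ker: "\<And>u1 u2 u3. \<iota> u1 * c0 + \<iota> u2 * c1 + \<iota> u3 * c2 = 0 \<Longrightarrow>
      \<exists>k. u1 = k * x \<and> u2 = k * y \<and> u3 = k * z"
    and m: "y\<^sup>2 \<noteq> x * z \<and> m = 2 \<or> x = 0 \<and> y = 0 \<and> z \<noteq> 0 \<and> m = 1"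
    and zero: "\<And>j. j \<le> 2 \<Longrightarrow>
      functional (2 + 2 * m) w (monom 1 j * (map_poly fr c * map_poly fr (map_poly fr c))) = 0"
    and i: "i \<le> 2 + 2 * m"
  shows "w i = 0"
proof -
  let ?L = "functional (2 + 2 * m) w"
  define c' where "c' = map_poly fr c"
  define c'' where "c'' = map_poly fr c'"
  have c': "c' = [:fr c0, fr c1, fr c2:]"
    by (simp add: c'_def c_def map_poly_pCons fr_hom)
  have conj: "map_poly fr c = c'" "map_poly fr c' = c''" "map_poly fr c'' = c"
    by (simp_all add: c'_def c''_def map_poly_fr3)
  have frL: "?L (map_poly fr p) = 0" if "?L p = 0" for p
    using that fr_functional[of "2 + 2 * m" w p] by (simp add: fr_hom)
  \<comment> \<open>Cancellation of the pair \<open>c\<close>, \<open>c'\<close>: if the functional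
    kills \<open>t^j c p\<close> and \<open>t^j c' p\<close> for \<open>j \<le> n\<close>, it kills
    \<open>t^j p\<close> for \<open>j \<le> n + m\<close>. The gain \<open>m\<close> is the degree
    bound of \<open>c\<close>.\<close>
  have vanish: "?L (monom 1 j * p) = 0"
    if "\<And>j. j \<le> n \<Longrightarrow> ?L (monom 1 j * (c * p)) = 0" "\<And>j. j \<le> n \<Longrightarrow> ?L (monom 1 j * (c' * p)) = 0"
      "1 \<le> n" "j \<le> n + m" for p n j
  proof -
    define u where "u j = ?L (monom 1 j * p)" for j
    have rel: "\<iota> x * u (j + 1) = \<iota> y * u j \<and> \<iota> y * u (j + 2) = \<iota> z * u (j + 1) \<and> \<iota> x * u (j + 2) = \<iota> z * u j"
      if j: "j \<le> n" for j
    proof -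
      have "c0 * u j + c1 * u (j + 1) + c2 * u (j + 2) = 0"
        using \<open>\<And>j. j \<le> n \<Longrightarrow> ?L (monom 1 j * (c * p)) = 0\<close>[OF j]
        by (simp only: c_def functional_quadratic u_def)
      moreover have "fr c0 * u j + fr c1 * u (j + 1) + fr c2 * u (j + 2) = 0"
        using \<open>\<And>j. j \<le> n \<Longrightarrow> ?L (monom 1 j * (c' * p)) = 0\<close>[OF j]
        by (simp only: c' functional_quadratic u_def)
      ultimately show ?thesis
        using orthogonal_to_conjugates[OF ker0 ker] by blast
    qed
    have "u j = 0"
      using m
    proof (elim disjE conjE)
      assume *: "y\<^sup>2 \<noteq> x * z" "m = 2"
      then have "(\<iota> y)\<^sup>2 \<noteq> \<iota> x * \<iota> z" by (metis emb_hom(4,7) emb_inj)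
      then show ?thesis using recurrence_trivial[OF rel] that(3,4) *(2) by simp
    next
      assume *: "x = 0" "y = 0" "z \<noteq> 0" "m = 1"
      \<comment> \<open>Each window is parallel to \<open>(0, 0, z)\<close>: its first two entries
        vanish and its last is free, so indices are reached only up to \<open>n + 1\<close>.\<close>
      then have "u i = 0 \<and> u (i + 1) = 0" if "i \<le> n" for i
        using rel[OF that] by (simp add: emb_hom emb_eq_0)
      then show ?thesis using that(4) *(4) by (cases j) auto
    qed
    then show ?thesis by (simp add: u_def)
  qed
  \<comment> \<open>Conjugating this product gives \<open>c * c''\<close>; cancelling
    \<open>c\<close> and \<open>c'\<close> leaves \<open>c''\<close> with \<open>m\<close> more
    shifts. Conjugation then yields \<open>c\<close> and \<open>c'\<close> alone, and a second
    cancellation reaches all monomials up to degree \<open>2 + 2 * m\<close>.\<close>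
  have c'c'': "?L (monom 1 j * (c' * c'')) = 0" if "j \<le> 2" for j
    using zero[OF that] by (simp add: conj)
  then have cc'': "?L (monom 1 j * (c * c'')) = 0" if "j \<le> 2" for j
    using frL[OF c'c''[OF that]] by (simp add: map_poly_fr_mult map_poly_fr_monom conj mult.commute)
  have c'': "?L (monom 1 j * c'') = 0" if "j \<le> 2 + m" for j
    by (rule vanish[OF cc'' c'c'']) (use that in auto)
  have c: "?L (monom 1 j * c) = 0" if "j \<le> 2 + m" for j
    using frL[OF c''[OF that]] by (simp add: map_poly_fr_mult map_poly_fr_monom conj)
  have c': "?L (monom 1 j * c') = 0" if "j \<le> 2 + m" for j
    using frL[OF c[OF that]] by (simp add: map_poly_fr_mult map_poly_fr_monom conj)
  have "?L (monom 1 i * 1) = 0"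
    by (rule vanish[of "2 + m"]) (use c c' i in auto)
  then show ?thesis using functional_monom[OF i] by (simp add: emb_eq_0)
qed

end

lemma points_in_span_singleton:
  assumes "v \<noteq> 0"
  shows "points_in (vec.span {v}) = {vec.span {v}}"
proof -
  have "vec.span {w} = vec.span {v}" if "w \<noteq> 0" "vec.span {w} \<subseteq> vec.span {v}" for w
    using that assms by (intro vec.subspace_dim_equal) auto
  then show ?thesis using assms by (auto simp: points_in_def pg_space_0)
qed

context bruck_bose_coordinates
begin

text \<open>The vector \<open>e i\<close> has as image the coefficient of \<open>t^i\<close> in the
  quadratic curve through the \<open>W\<close>s multiplied by the two conjugates of
  \<open>c\<close>. A relation \<open>w\<close> among them gives a combination of \<open>W0\<close>,
  \<open>W1\<close>, \<open>W2\<close> with coefficients \<open>?L (t^j d)\<close>. These vanish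
  because the \<open>W\<close>s are independent, and \<open>functional_trivial\<close>
  applies.\<close>

lemma conic_curve:
  fixes W0 W1 W2 :: "'c ^ 3" and x y z :: 'q and m :: nat
  defines "c \<equiv> [:W0 $ 3, W1 $ 3, W2 $ 3:]"
  assumes det: "det3 W0 W1 W2 \<noteq> 0"
    and ker0: "\<iota> x * W0 $ 3 + \<iota> y * W1 $ 3 + \<iota> z * W2 $ 3 = 0"
    and ker: "\<And>u1 u2 u3. \<iota> u1 * W0 $ 3 + \<iota> u2 * W1 $ 3 + \<iota> u3 * W2 $ 3 = 0 \<Longrightarrow>
      \<exists>k. u1 = k * x \<and> u2 = k * y \<and> u3 = k * z"
    and m: "y\<^sup>2 \<noteq> x * z \<and> m = 2 \<or> x = 0 \<and> y = 0 \<and> z \<noteq> 0 \<and> m = 1"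
  obtains e a where
    "\<And>w. (\<Sum>i\<le>2 + 2 * m. w i *s e i) = 0 \<Longrightarrow> \<forall>i\<le>2 + 2 * m. w i = 0"
    "\<And>\<theta>. \<Lambda> (\<Sum>i\<le>2 + 2 * m. \<theta> ^ i *s e i) =
      poly (map_poly fr c * map_poly fr (map_poly fr c)) (\<iota> \<theta>) *s (W0 + \<iota> \<theta> *s W1 + (\<iota> \<theta>)\<^sup>2 *s W2)"
    "\<Lambda> (e (2 + 2 * m)) = a *s W2"
proof -
  define d where "d = map_poly fr c * map_poly fr (map_poly fr c)"
  define g where "g j = [:W0 $ j, W1 $ j, W2 $ j:]" for j
  define E :: "nat \<Rightarrow> 'c ^ 3" where "E i = (\<chi> j. coeff (g j * d) i)" for i
  have g3: "g 3 = c" by (simp add: g_def c_def)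
  \<comment> \<open>The product of \<open>c\<close> with its conjugates is fixed by conjugation. It
    is the third coordinate of the curve, the only one that \<Lambda> restricts to
    \<open>range \<iota>\<close>.\<close>
  have "coeff (c * d) i \<in> range \<iota>" for i
  proof -
    have "map_poly fr (c * d) = c * d"
      by (simp add: d_def map_poly_fr_mult map_poly_fr3 mult_ac)
    then have "fr (coeff (c * d) i) = coeff (c * d) i"
      by (metis coeff_map_poly fr_hom(1))
    then show ?thesis unfolding fr_fixed_iff .
  qed
  then have "\<exists>v. \<Lambda> v = E i" for i by (intro \<Lambda>_surj) (simp add: E_def g3)
  then obtain e where e: "\<Lambda> (e i) = E i" for i by metis
  \<comment> \<open>In this case the kernel is spanned by \<open>(0, 0, z)\<close>, so the leading
    coefficient of \<open>c\<close> vanishes and every conjugate loses a degree.\<close>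
  have c2: "W2 $ 3 = 0" if "m = 1"
    using ker0 that m by (auto simp: emb_hom emb_eq_0)
  have "degree c \<le> m"
    using m c2 by (auto simp: c_def)
  then have "degree (map_poly fr c) \<le> m" "degree (map_poly fr (map_poly fr c)) \<le> m"
    by (auto simp: fr_eq_0 degree_map_poly)
  then have deg_d: "degree d \<le> 2 * m"
    unfolding d_def using degree_mult_le[of "map_poly fr c" "map_poly fr (map_poly fr c)"] by linarith
  have "degree (g j) \<le> 2" for j by (simp add: g_def)
  then have deg: "degree (g j * d) \<le> 2 + 2 * m" for j
    using degree_mult_le[of "g j" d] deg_d by (metis add_mono order.trans)
  show thesis
  proof (rule that)
    fix w assume w: "(\<Sum>i\<le>2 + 2 * m. w i *s e i) = 0"
    let ?L = "functional (2 + 2 * m) w"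
    have "?L d *s W0 + ?L (monom 1 1 * d) *s W1 + ?L (monom 1 2 * d) *s W2
        = \<Lambda> (\<Sum>i\<le>2 + 2 * m. w i *s e i)"
    proof (subst vec_eq_iff, intro allI)
      fix j
      have "?L (monom 1 0 * (g j * d)) =
          ?L d * W0 $ j + ?L (monom 1 1 * d) * W1 $ j + ?L (monom 1 2 * d) * W2 $ j"
        unfolding g_def functional_quadratic
        by (simp add: mult.commute monom_0 numeral_2_eq_2 flip: one_pCons)
      moreover have "?L (monom 1 0 * (g j * d)) = \<Lambda> (\<Sum>i\<le>2 + 2 * m. w i *s e i) $ j"
        unfolding functional_def \<Lambda>_sum \<Lambda>_scale e
        by (simp add: E_def monom_0 flip: one_pCons)
      ultimately show "(?L d *s W0 + ?L (monom 1 1 * d) *s W1 + ?L (monom 1 2 * d) *s W2) $ j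
        = \<Lambda> (\<Sum>i\<le>2 + 2 * m. w i *s e i) $ j" by simp
    qed
    then have "?L d *s W0 + ?L (monom 1 1 * d) *s W1 + ?L (monom 1 2 * d) *s W2 = 0"
      by (simp only: w \<Lambda>_0)
    note zero = det3_independent[OF det this]
    have "?L (monom 1 j * d) = 0" if j: "j \<le> 2" for j
    proof -
      consider "j = 0" | "j = 1" | "j = 2" using j by linarith
      then show ?thesis using zero by cases (simp_all add: monom_0 flip: one_pCons)
    qed
    then show "\<forall>i\<le>2 + 2 * m. w i = 0"
      using functional_trivial[OF ker0 ker m] by (auto simp: d_def c_def)
  next
    fix \<theta>
    show "\<Lambda> (\<Sum>i\<le>2 + 2 * m. \<theta> ^ i *s e i) =
      poly (map_poly fr c * map_poly fr (map_poly fr c)) (\<iota> \<theta>) *s (W0 + \<iota> \<theta> *s W1 + (\<iota> \<theta>)\<^sup>2 *s W2)"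
    proof (subst vec_eq_iff, intro allI)
      fix j
      have "\<Lambda> (\<Sum>i\<le>2 + 2 * m. \<theta> ^ i *s e i) $ j = (\<Sum>i\<le>2 + 2 * m. coeff (g j * d) i * \<iota> \<theta> ^ i)"
        unfolding \<Lambda>_sum \<Lambda>_scale e by (simp add: E_def emb_hom mult.commute)
      also have "\<dots> = poly (g j * d) (\<iota> \<theta>)"
        unfolding poly_altdef
        by (rule sum.mono_neutral_right) (use deg[of j] in \<open>auto simp: coeff_eq_0\<close>)
      also have "\<dots> = poly d (\<iota> \<theta>) * (W0 $ j + \<iota> \<theta> * W1 $ j + (\<iota> \<theta>)\<^sup>2 * W2 $ j)"
        by (simp add: g_def power2_eq_square algebra_simps)
      finally show "\<Lambda> (\<Sum>i\<le>2 + 2 * m. \<theta> ^ i *s e i) $ j =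
        (poly (map_poly fr c * map_poly fr (map_poly fr c)) (\<iota> \<theta>) *s (W0 + \<iota> \<theta> *s W1 + (\<iota> \<theta>)\<^sup>2 *s W2)) $ j"
        by (simp only: d_def vector_smult_component vector_add_component)
    qed
  next
    \<comment> \<open>Only \<open>W2\<close> times the coefficient of \<open>d\<close> in degree
      \<open>2 * m\<close> contributes to the top coefficient. That this factor is nonzero follows
      later from the independence of the \<open>e i\<close>.\<close>
    have "coeff d (Suc (2 * m)) = 0" "coeff d (Suc (Suc (2 * m))) = 0"
      using deg_d by (simp_all add: coeff_eq_0)
    then show "\<Lambda> (e (2 + 2 * m)) = coeff d (2 * m) *s W2"
      by (simp add: e E_def g_def vec_eq_iff coeff_pCons mult.commute)
  qed
qed

text \<open>Multiplying a vector by a nonzero value of \<open>d\<close> does not change the point it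
  represents, so the affine points of the conic give the affine points of the curve. The two cases
  differ only at the parameter \<infinity>: \<open>W2\<close> represents an affine point if
  \<open>m = 2\<close> and a spread plane if \<open>m = 1\<close>.\<close>

lemma conic_representation:
  fixes W0 W1 W2 :: "'c ^ 3" and x y z :: 'q and m :: nat
  assumes det: "det3 W0 W1 W2 \<noteq> 0"
    and ker0: "\<iota> x * W0 $ 3 + \<iota> y * W1 $ 3 + \<iota> z * W2 $ 3 = 0"
    and ker: "\<And>u1 u2 u3. \<iota> u1 * W0 $ 3 + \<iota> u2 * W1 $ 3 + \<iota> u3 * W2 $ 3 = 0 \<Longrightarrow>
      \<exists>k. u1 = k * x \<and> u2 = k * y \<and> u3 = k * z"
    and m: "y\<^sup>2 \<noteq> x * z \<and> m = 2 \<or> x = 0 \<and> y = 0 \<and> z \<noteq> 0 \<and> m = 1"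
  defines "X \<equiv> (\<Union>\<theta>. points_in (rep (W0 + \<iota> \<theta> *s W1 + (\<iota> \<theta>)\<^sup>2 *s W2))) \<union> points_in (rep W2)"
  shows "normal_rational_curve 6 X \<or>
    (\<exists>N \<pi>. normal_rational_curve 4 N \<and> \<pi> \<in> S \<and> X = N \<union> points_in \<pi>)"
proof -
  define c where "c = [:W0 $ 3, W1 $ 3, W2 $ 3:]"
  define d where "d = map_poly fr c * map_poly fr (map_poly fr c)"
  define \<gamma> where "\<gamma> \<theta> = W0 + \<iota> \<theta> *s W1 + (\<iota> \<theta>)\<^sup>2 *s W2" for \<theta>
  obtain e a where indep: "\<And>w. (\<Sum>i\<le>2 + 2 * m. w i *s e i) = 0 \<Longrightarrow> \<forall>i\<le>2 + 2 * m. w i = 0"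
    and V: "\<And>\<theta>. \<Lambda> (\<Sum>i\<le>2 + 2 * m. \<theta> ^ i *s e i) = poly d (\<iota> \<theta>) *s \<gamma> \<theta>"
    and e_top: "\<Lambda> (e (2 + 2 * m)) = a *s W2"
    unfolding \<gamma>_def d_def c_def by (rule conic_curve[OF det ker0 ker m]) blast+
  define N where "N = {vec.span {\<Sum>i\<le>2 + 2 * m. \<theta> ^ i *s e i} | \<theta>. True} \<union> {vec.span {e (2 + 2 * m)}}"
  have N: "normal_rational_curve (2 + 2 * m) N"
    unfolding N_def by (rule normal_rational_curveI[OF indep])
  have e0: "e (2 + 2 * m) \<noteq> 0"
  proof
    assume "e (2 + 2 * m) = 0"
    then have "(\<Sum>i\<le>2 + 2 * m. (if i = 2 + 2 * m then 1 else 0) *s e i) = 0"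
      by (intro sum.neutral) auto
    from indep[OF this] show False by auto
  qed
  then have a: "a \<noteq> 0" using e_top \<Lambda>_eq_0[of "e (2 + 2 * m)"] by auto
  \<comment> \<open>At infinity, \<open>(1, \<theta>, \<theta>^2)\<close> would be a multiple of
    \<open>(x, y, z)\<close>. But that triple is off the conic or equals
    \<open>(0, 0, z)\<close>.\<close>
  have \<gamma>3: "\<gamma> \<theta> $ 3 \<noteq> 0" for \<theta>
  proof
    assume "\<gamma> \<theta> $ 3 = 0"
    then have "\<iota> 1 * W0 $ 3 + \<iota> \<theta> * W1 $ 3 + \<iota> (\<theta>\<^sup>2) * W2 $ 3 = 0"
      by (simp add: \<gamma>_def emb_hom)
    then obtain k where k: "1 = k * x" "\<theta> = k * y" "\<theta>\<^sup>2 = k * z" using ker by blast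
    then have "k\<^sup>2 * y\<^sup>2 = k\<^sup>2 * (x * z)"
      by (metis power_mult_distrib power2_eq_square mult.assoc mult.left_commute mult_1)
    then show False using k m by auto
  qed
  have affine: "points_in (rep (\<gamma> \<theta>)) = {vec.span {\<Sum>i\<le>2 + 2 * m. \<theta> ^ i *s e i}}" for \<theta>
  proof -
    have "poly c (\<iota> \<theta>) = \<gamma> \<theta> $ 3"
      by (simp add: c_def \<gamma>_def power2_eq_square algebra_simps)
    \<comment> \<open>As \<open>\<iota> \<theta>\<close> is fixed by \<open>fr\<close>, the values
      of the conjugate polynomials there are the conjugates of the nonzero value of
      \<open>c\<close>.\<close>
    then have "poly d (\<iota> \<theta>) \<noteq> 0"
      using \<gamma>3[of \<theta>] poly_map_poly_fr[of c "\<iota> \<theta>"] poly_map_poly_fr[of "map_poly fr c" "\<iota> \<theta>"]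
      by (simp add: d_def fr_eq_0)
    define v where "v = (\<Sum>i\<le>2 + 2 * m. \<theta> ^ i *s e i)"
    have v: "\<Lambda> v = poly d (\<iota> \<theta>) *s \<gamma> \<theta>" unfolding v_def by (rule V)
    then have "\<Lambda> v $ 3 \<noteq> 0" using \<gamma>3[of \<theta>] \<open>poly d (\<iota> \<theta>) \<noteq> 0\<close> by simp
    then have "v \<noteq> 0" "rep (\<Lambda> v) = vec.span {v}" by (auto simp: \<Lambda>_0 rep_affine)
    moreover have "rep (\<gamma> \<theta>) = rep (\<Lambda> v)"
      using \<open>poly d (\<iota> \<theta>) \<noteq> 0\<close> by (simp add: v rep_scale)
    ultimately show ?thesis
      unfolding v_def[symmetric] by (simp add: points_in_span_singleton)
  qed
  have X: "X = {vec.span {\<Sum>i\<le>2 + 2 * m. \<theta> ^ i *s e i} | \<theta>. True} \<union> points_in (rep W2)"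
    unfolding X_def using affine[unfolded \<gamma>_def] by auto
  from m show ?thesis
  proof (elim disjE conjE)
    assume *: "y\<^sup>2 \<noteq> x * z" "m = 2"
    have "W2 $ 3 \<noteq> 0"
    proof
      assume "W2 $ 3 = 0"
      then obtain k where "0 = k * x" "0 = k * y" "1 = k * z" using ker[of 0 0 1] by (auto simp: emb_hom)
      then show False using *(1) by auto
    qed
    then have "\<Lambda> (e (2 + 2 * m)) $ 3 \<noteq> 0" using a unfolding e_top by simp
    moreover have "rep W2 = rep (\<Lambda> (e (2 + 2 * m)))" using a unfolding e_top by (simp add: rep_scale)
    ultimately have "points_in (rep W2) = {vec.span {e (2 + 2 * m)}}"
      using rep_affine points_in_span_singleton[OF e0] by simp
    then have "X = N" by (simp add: X N_def)
    then show ?thesis using N *(2) by simp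
  next
    assume *: "x = 0" "y = 0" "z \<noteq> 0" "m = 1"
    then have "W2 $ 3 = 0" using ker0 by (simp add: emb_hom emb_eq_0)
    moreover have "W2 \<noteq> 0" using det by (auto simp: det3_def)
    ultimately have "rep W2 \<in> S" by (simp add: rep_in_S_iff)
    \<comment> \<open>The last point of the curve already lies in the spread plane, so adding it to
      the union changes nothing.\<close>
    moreover have "vec.span {e (2 + 2 * m)} \<in> points_in (rep W2)"
    proof -
      have "e (2 + 2 * m) \<in> rep W2" using e_top by (auto simp: in_rep_iff)
      then have "vec.span {e (2 + 2 * m)} \<subseteq> rep W2"
        by (intro vec.span_minimal subspace_rep) simp
      then show ?thesis using e0 by (auto simp: points_in_def pg_space_0)
    qed
    then have "X = N \<union> points_in (rep W2)" by (auto simp: X N_def)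
    ultimately show ?thesis using N *(4) by auto
  qed
qed

end

section \<open>Conics of tangent subplanes\<close>

lemma plane_lines_subset: "l \<in> plane_lines \<Longrightarrow> l \<subseteq> plane_points"
  by (auto simp: plane_lines_def points_in_def)

lemma span_point_in_plane_points: "v \<noteq> 0 \<Longrightarrow> vec.span {v} \<in> plane_points"
  by (auto simp: pg_space_0)

lemma plane_collinear_iff:
  fixes u v w :: "'a::field ^ 3"
  assumes "u \<noteq> 0" "v \<noteq> 0" "w \<noteq> 0"
  shows "(\<exists>l\<in>plane_lines. vec.span {u} \<in> l \<and> vec.span {v} \<in> l \<and> vec.span {w} \<in> l) \<longleftrightarrow> det3 u v w = 0"
proof -
  have "vec.span {x} \<in> points_in U \<longleftrightarrow> x \<in> U" if "x \<noteq> 0" "vec.subspace U" for x :: "'a ^ 3" and U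
    using that vec.span_minimal[of "{x}" U] vec.span_base[of x "{x}"]
    by (auto simp: points_in_def pg_space_0)
  then show ?thesis
    unfolding det3_eq_0_iff plane_lines_def using assms by (auto simp: pg_space_def)
qed

text \<open>A line meeting \<open>B\<close> in two points induces a line of the subplane, which is
  the image of a line. For the converse direction two distinct image points are therefore
  needed.\<close>

lemma collinear_transfer:
  fixes f :: "('q::field ^ 3) set \<Rightarrow> ('c::field ^ 3) set"
  assumes f: "incidence_iso f plane_points plane_lines B (induced_lines B)"
    and B: "B \<subseteq> plane_points"
    and PQR: "P \<in> plane_points" "Q \<in> plane_points" "R \<in> plane_points"
  shows "(\<exists>l\<in>plane_lines. P \<in> l \<and> Q \<in> l \<and> R \<in> l) \<longleftrightarrow>
    (\<exists>l\<in>plane_lines. f P \<in> l \<and> f Q \<in> l \<and> f R \<in> l)" (is "?L \<longleftrightarrow> ?R")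
proof
  have bij: "bij_betw f plane_points B" and lines: "(`) f ` plane_lines = induced_lines B"
    using f by (auto simp: incidence_iso_def)
  have inj: "f X = f Y \<longleftrightarrow> X = Y" if "X \<in> plane_points" "Y \<in> plane_points" for X Y
    using bij that by (auto simp: bij_betw_def inj_on_def)
  {
    assume ?L
    then obtain l where l: "l \<in> plane_lines" "P \<in> l" "Q \<in> l" "R \<in> l" by blast
    then have "f ` l \<in> induced_lines B" using lines by blast
    then obtain l' where "l' \<in> plane_lines" "f ` l = l' \<inter> B" unfolding induced_lines_def by blast
    then show ?R using l by blast
  }
  assume ?R
  then obtain l where l: "l \<in> plane_lines" "f P \<in> l" "f Q \<in> l" "f R \<in> l" by blast
  have in_B: "f P \<in> B" "f Q \<in> B" "f R \<in> B" using bij PQR by (auto simp: bij_betw_def)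
  show ?L
  proof (cases "P = Q \<and> P = R")
    \<comment> \<open>With all three points equal, any line through the point serves; it exists
      because \<open>det3 u u u = 0\<close>.\<close>
    case True
    obtain u where "u \<noteq> 0" "P = vec.span {u}" using PQR(1) by (auto simp: pg_space_0)
    then show ?thesis
      using True plane_collinear_iff[of u u u] by (auto simp: det3_same)
  next
    case False
    then have "f P \<noteq> f Q \<or> f P \<noteq> f R" using inj PQR by blast
    then have "\<exists>x\<in>l \<inter> B. \<exists>y\<in>l \<inter> B. x \<noteq> y" using l in_B by blast
    then have "l \<inter> B \<in> induced_lines B" unfolding induced_lines_def using l(1) by blast
    then have "l \<inter> B \<in> (`) f ` plane_lines" by (simp only: lines)
    then obtain l0 where l0: "l \<inter> B = f ` l0" "l0 \<in> plane_lines" by (rule imageE)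
    have "X \<in> l0" if X: "X \<in> plane_points" "f X \<in> l" "f X \<in> B" for X
    proof -
      have "f X \<in> f ` l0" using X l0(1) by auto
      then obtain Y where Y: "f X = f Y" "Y \<in> l0" by (rule imageE)
      then have "Y \<in> plane_points" using plane_lines_subset[OF l0(2)] by auto
      then show ?thesis using X(1) Y inj by simp
    qed
    then show ?thesis using l l0(2) in_B PQR by (intro bexI[of _ l0]) simp_all
  qed
qed

context bruck_bose_coordinates
begin

text \<open>The fundamental theorem is applied to the composite of \<open>f\<close> and \<phi>,
  lifted to vectors by choosing \<open>h v\<close> with \<open>rep (h v)\<close> the image. The
  field embedding then differs from \<iota> only by an automorphism \<rho> of
  \<open>'q\<close>.\<close>

lemma subplane_coordinates:
  fixes f :: "('q ^ 3) set \<Rightarrow> ('c ^ 3) set" and \<phi> :: "('c ^ 3) set \<Rightarrow> ('q ^ 7) set"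
  assumes f: "incidence_iso f plane_points plane_lines B (induced_lines B)"
    and B: "B \<subseteq> plane_points"
    and \<phi>: "incidence_iso \<phi> plane_points plane_lines (bb_points H S) (bb_lines H S)"
  obtains \<rho> A1 A2 A3 where "field_embedding \<rho>" "surj \<rho>" "det3 A1 A2 A3 \<noteq> 0"
    "\<And>v. v \<noteq> 0 \<Longrightarrow> \<phi> (f (vec.span {v})) =
      rep (\<iota> (\<rho> (v $ 1)) *s A1 + \<iota> (\<rho> (v $ 2)) *s A2 + \<iota> (\<rho> (v $ 3)) *s A3)"
    "\<And>v :: 'q ^ 3. v \<noteq> 0 \<Longrightarrow> \<iota> (\<rho> (v $ 1)) *s A1 + \<iota> (\<rho> (v $ 2)) *s A2 + \<iota> (\<rho> (v $ 3)) *s A3 \<noteq> 0"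
proof -
  have f_bij: "bij_betw f plane_points B" using f by (simp add: incidence_iso_def)
  have \<phi>_bij: "bij_betw \<phi> plane_points (bb_points H S)"
    and \<phi>_lines: "(`) \<phi> ` plane_lines = bb_lines H S"
    using \<phi> by (auto simp: incidence_iso_def)
  have fB: "f (vec.span {v}) \<in> plane_points" if "v \<noteq> 0" for v
    using f_bij B span_point_in_plane_points[OF that] by (auto simp: bij_betw_def)
  have "\<exists>w. w \<noteq> 0 \<and> \<phi> (f (vec.span {v})) = rep w" if "v \<noteq> 0" for v
  proof -
    have "\<phi> (f (vec.span {v})) \<in> bb_points H S"
      using \<phi>_bij fB[OF that] by (auto simp: bij_betw_def)
    then show ?thesis unfolding bb_points_eq by blast
  qed
  then obtain h where h: "\<And>v. v \<noteq> 0 \<Longrightarrow> h v \<noteq> 0 \<and> \<phi> (f (vec.span {v})) = rep (h v)"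
    by metis
  have col: "det3 u v w = 0 \<longleftrightarrow> det3 (h u) (h v) (h w) = 0" if nz: "u \<noteq> 0" "v \<noteq> 0" "w \<noteq> 0" for u v w
  proof -
    have mem: "X \<in> l \<longleftrightarrow> \<phi> X \<in> \<phi> ` l" if "l \<in> plane_lines" "X \<in> plane_points" for l X
      using \<phi>_bij that plane_lines_subset[OF that(1)]
      by (metis bij_betw_def inj_on_image_mem_iff)
    have "det3 u v w = 0 \<longleftrightarrow>
        (\<exists>l\<in>plane_lines. f (vec.span {u}) \<in> l \<and> f (vec.span {v}) \<in> l \<and> f (vec.span {w}) \<in> l)"
      unfolding plane_collinear_iff[OF nz, symmetric]
      by (intro collinear_transfer[OF f B] span_point_in_plane_points nz)
    also have "\<dots> \<longleftrightarrow> (\<exists>l\<in>plane_lines. \<phi> (f (vec.span {u})) \<in> \<phi> ` l \<and> \<phi> (f (vec.span {v})) \<in> \<phi> ` l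
        \<and> \<phi> (f (vec.span {w})) \<in> \<phi> ` l)"
      using mem fB nz by (intro bex_cong refl) simp
    also have "\<dots> \<longleftrightarrow> (\<exists>m\<in>bb_lines H S. rep (h u) \<in> m \<and> rep (h v) \<in> m \<and> rep (h w) \<in> m)"
      unfolding \<phi>_lines[symmetric] using h nz by simp
    also have "\<dots> \<longleftrightarrow> det3 (h u) (h v) (h w) = 0"
      using h nz by (intro bb_collinear_iff) auto
    finally show ?thesis .
  qed
  obtain \<sigma> A1 A2 A3 where \<sigma>: "field_embedding \<sigma>" and A: "det3 A1 A2 A3 \<noteq> 0"
    and h_eq: "\<And>v. v \<noteq> 0 \<Longrightarrow> \<exists>k. k \<noteq> 0 \<and> h v = k *s (\<sigma> (v $ 1) *s A1 + \<sigma> (v $ 2) *s A2 + \<sigma> (v $ 3) *s A3)"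
    using fundamental_theorem_projective_plane[OF col] by blast
  \<comment> \<open>Both images are the set of roots of \<open>X^q = X\<close> in
    \<open>'c\<close>.\<close>
  have "range \<sigma> = range \<iota>"
    using range_field_embedding[OF \<sigma>] range_field_embedding[OF emb] by simp
  then have "\<exists>y. \<sigma> x = \<iota> y" for x by blast
  then obtain \<rho> where \<rho>: "\<sigma> x = \<iota> (\<rho> x)" for x by metis
  have emb_\<rho>: "field_embedding \<rho>"
    using field_embedding_hom[OF \<sigma>] unfolding field_embedding_def
    by (simp add: \<rho> flip: emb_inj) (simp add: emb_hom)
  have surj_\<rho>: "surj \<rho>"
    by (rule finite_UNIV_inj_surj[OF finite]) (simp add: inj_on_def field_embedding_inj[OF emb_\<rho>])
  have point: "\<phi> (f (vec.span {v})) =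
      rep (\<iota> (\<rho> (v $ 1)) *s A1 + \<iota> (\<rho> (v $ 2)) *s A2 + \<iota> (\<rho> (v $ 3)) *s A3)" if "v \<noteq> 0" for v
    using h[OF that] h_eq[OF that] unfolding \<rho> by (metis rep_scale)
  have nz: "\<iota> (\<rho> (v $ 1)) *s A1 + \<iota> (\<rho> (v $ 2)) *s A2 + \<iota> (\<rho> (v $ 3)) *s A3 \<noteq> 0" if "v \<noteq> 0" for v :: "'q ^ 3"
    using h[OF that] h_eq[OF that] unfolding \<rho> by (metis vec.scale_zero_right)
  show thesis by (rule that[OF emb_\<rho> surj_\<rho> A point nz])
qed

end

text \<open>On \<open>y^2 = x z\<close> a point with nonzero \<open>x\<close> scales to
  \<open>(1, t, t^2)\<close>, and \<open>x = 0\<close> forces \<open>y = 0\<close>; the point of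
  \<open>m2\<close> is the parameter \<infinity>.\<close>

lemma nondegenerate_conic_parametrization:
  fixes Q :: "'a::field ^ 3 \<Rightarrow> 'a"
  assumes det: "det3 m0 m1 m2 \<noteq> 0" and d: "d \<noteq> 0"
    and Q: "\<And>x y z. Q (x *s m0 + y *s m1 + z *s m2) = d * (y\<^sup>2 - x * z)"
  shows "{P \<in> plane_points. \<forall>v\<in>P. Q v = 0} =
    {vec.span {m0 + t *s m1 + t\<^sup>2 *s m2} | t. True} \<union> {vec.span {m2}}"
proof (intro set_eqI iffI)
  fix P assume "P \<in> {P \<in> plane_points. \<forall>v\<in>P. Q v = 0}"
  then obtain v where v: "v \<noteq> 0" "P = vec.span {v}" "Q v = 0"
    using vec.span_base by (auto simp: pg_space_0)
  obtain x y z where xyz: "v = x *s m0 + y *s m1 + z *s m2"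
    using det3_combination[OF det] by blast
  have yxz: "y\<^sup>2 = x * z" using v(3) d by (simp add: xyz Q)
  have span_scale: "vec.span {k *s w} = vec.span {w}" if "k \<noteq> 0" for k and w :: "'a ^ 3"
  proof -
    have "w = inverse k *s (k *s w)" using that by simp
    then have "w \<in> vec.span {k *s w}" by (metis vec.span_scale vec.span_base insertI1)
    moreover have "k *s w \<in> vec.span {w}" by (intro vec.span_scale vec.span_base) simp
    ultimately show ?thesis by (intro subset_antisym vec.span_minimal) auto
  qed
  show "P \<in> {vec.span {m0 + t *s m1 + t\<^sup>2 *s m2} | t. True} \<union> {vec.span {m2}}"
  proof (cases "x = 0")
    case True
    then have "v = z *s m2" using yxz xyz by simp
    moreover from this have "z \<noteq> 0" using v(1) by auto
    ultimately show ?thesis using v(2) span_scale by simp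
  next
    case False
    then have "x * (y / x) = y" "x * (y / x)\<^sup>2 = z"
      using yxz by (simp_all add: power2_eq_square field_simps)
    then have "v = x *s (m0 + (y / x) *s m1 + (y / x)\<^sup>2 *s m2)"
      unfolding xyz vec.scale_right_distrib vec.scale_scale by simp
    then have "P = vec.span {m0 + (y / x) *s m1 + (y / x)\<^sup>2 *s m2}"
      using v(2) span_scale[OF False] by metis
    then show ?thesis by blast
  qed
next
  fix P assume "P \<in> {vec.span {m0 + t *s m1 + t\<^sup>2 *s m2} | t. True} \<union> {vec.span {m2}}"
  then obtain x y z where P: "P = vec.span {x *s m0 + y *s m1 + z *s m2}" "y\<^sup>2 = x * z" "x \<noteq> 0 \<or> z \<noteq> 0"
  proof (elim UnE CollectE exE conjE)
    fix t assume "P = vec.span {m0 + t *s m1 + t\<^sup>2 *s m2}"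
    then show thesis using that[of 1 t "t\<^sup>2"] by simp
  next
    assume "P \<in> {vec.span {m2}}"
    then show thesis using that[of 0 0 1] by simp
  qed
  have "x *s m0 + y *s m1 + z *s m2 \<noteq> 0" using det3_independent[OF det] P(3) by blast
  moreover have "Q (k *s (x *s m0 + y *s m1 + z *s m2)) = 0" for k
  proof -
    have "Q ((k * x) *s m0 + (k * y) *s m1 + (k * z) *s m2) = d * (k\<^sup>2 * (y\<^sup>2 - x * z))"
      unfolding Q by (simp add: power2_eq_square algebra_simps)
    then show ?thesis using P(2) by (simp add: vec.scale_right_distrib)
  qed
  then have "\<forall>v\<in>P. Q v = 0" by (auto simp: P(1) vec.span_singleton)
  ultimately show "P \<in> {P \<in> plane_points. \<forall>v\<in>P. Q v = 0}"
    using span_point_in_plane_points by (simp add: P(1))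
qed

theorem theorem4p3:
  fixes \<iota> :: "'q::{field,finite} \<Rightarrow> 'c::{field,finite}"
    and H :: "('q ^ 7) set" and S :: "('q ^ 7) set set"
    and linf :: "('c ^ 3) set set" and \<phi> :: "('c ^ 3) set \<Rightarrow> ('q ^ 7) set"
    and B C :: "('c ^ 3) set set"
  assumes "CARD('q) \<ge> 6"
    and "CARD('c) = CARD('q) ^ 3"
    and "field_embedding \<iota>"
    and "H \<in> pg_space 5"
    and "regular_2_spread \<iota> H S"
    and "linf \<in> plane_lines"
    and "bruck_bose_representation H S linf \<phi>"
    and "subplane_of_order CARD('q) B"
    and "card (B \<inter> linf) = 1"
    and "conic_of_subplane TYPE('q) B C"
  shows "normal_rational_curve 6 (bb_set \<phi> C) \<or>
         (\<exists>N \<pi>. normal_rational_curve 4 N \<and> \<pi> \<in> S \<and> bb_set \<phi> C = N \<union> points_in \<pi>)"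
proof -
  interpret cubic_extension \<iota> using assms(2,3) by unfold_locales
  obtain \<Lambda> where \<Lambda>: "bruck_bose_coordinates \<iota> \<Lambda> H S"
    using bruck_bose_coordinates_exist[OF assms(4,5)] by blast
  interpret bruck_bose_coordinates \<iota> \<Lambda> H S by (rule \<Lambda>)
  have \<phi>: "incidence_iso \<phi> plane_points plane_lines (bb_points H S) (bb_lines H S)"
    and \<phi>_linf: "\<phi> ` linf = S"
    using assms(7) by (auto simp: bruck_bose_representation_def)
  have B: "B \<subseteq> plane_points" using assms(8) by (simp add: subplane_of_order_def)
  obtain f :: "('q ^ 3) set \<Rightarrow> ('c ^ 3) set" and D
    where f: "incidence_iso f plane_points plane_lines B (induced_lines B)"
      and D: "nondegenerate_conic D" and C: "C = f ` D"
    using assms(10) unfolding conic_of_subplane_def by blast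
  obtain Q where Q: "quadratic_form Q" "nondegenerate_form Q" "D = {P \<in> plane_points. \<forall>v\<in>P. Q v = 0}"
    using D unfolding nondegenerate_conic_def by blast
  obtain \<rho> A1 A2 A3 where \<rho>: "field_embedding \<rho>" "surj \<rho>" and A: "det3 A1 A2 A3 \<noteq> 0"
    and point: "\<And>v. v \<noteq> 0 \<Longrightarrow> \<phi> (f (vec.span {v})) =
      rep (\<iota> (\<rho> (v $ 1)) *s A1 + \<iota> (\<rho> (v $ 2)) *s A2 + \<iota> (\<rho> (v $ 3)) *s A3)"
    and point_nz: "\<And>v :: 'q ^ 3. v \<noteq> 0 \<Longrightarrow>
      \<iota> (\<rho> (v $ 1)) *s A1 + \<iota> (\<rho> (v $ 2)) *s A2 + \<iota> (\<rho> (v $ 3)) *s A3 \<noteq> 0"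
    by (rule subplane_coordinates[OF f B \<phi>]) blast
  note \<rho>_hom = field_embedding_hom[OF \<rho>(1)]
  define h :: "'q ^ 3 \<Rightarrow> 'c ^ 3"
    where "h v = \<iota> (\<rho> (v $ 1)) *s A1 + \<iota> (\<rho> (v $ 2)) *s A2 + \<iota> (\<rho> (v $ 3)) *s A3" for v
  have f_bij: "bij_betw f plane_points B" using f by (simp add: incidence_iso_def)
  have \<phi>_inj: "inj_on \<phi> plane_points" using \<phi> by (simp add: incidence_iso_def bij_betw_def)

  obtain P0 where P0: "P0 \<in> plane_points" "B \<inter> linf = {f P0}"
  proof -
    obtain X where "B \<inter> linf = {X}" using assms(9) by (auto simp: card_1_singleton_iff)
    moreover from this have "X \<in> f ` plane_points" using f_bij by (auto simp: bij_betw_def)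
    ultimately show thesis using that by blast
  qed
  then obtain p where p: "p \<noteq> 0" "P0 = vec.span {p}" by (auto simp: pg_space_0)
  \<comment> \<open>Tangency in coordinates: exactly one point of the small plane has its image at
    infinity.\<close>
  have tangent: "h v $ 3 = 0 \<longleftrightarrow> vec.span {v} = vec.span {p}" if v: "v \<noteq> 0" for v :: "'q ^ 3"
  proof -
    have fv: "f (vec.span {v}) \<in> B"
      using f_bij span_point_in_plane_points[OF v] by (auto simp: bij_betw_def)
    have "h v $ 3 = 0 \<longleftrightarrow> \<phi> (f (vec.span {v})) \<in> \<phi> ` linf"
      using rep_in_S_iff[of "h v"] point[OF v] point_nz[OF v] by (simp add: \<phi>_linf h_def)
    also have "\<dots> \<longleftrightarrow> f (vec.span {v}) \<in> linf"
      using fv B by (intro inj_on_image_mem_iff[OF \<phi>_inj _ plane_lines_subset[OF assms(6)]]) auto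
    also have "\<dots> \<longleftrightarrow> f (vec.span {v}) = f P0" using fv P0(2) by blast
    also have "\<dots> \<longleftrightarrow> vec.span {v} = P0"
      using f_bij P0(1) span_point_in_plane_points[OF v] by (auto simp: bij_betw_def inj_on_def)
    finally show ?thesis by (simp add: p)
  qed

  \<comment> \<open>If the point at infinity is on the conic, it is chosen as \<open>v0\<close>, so
    that it becomes the parameter \<infinity>; otherwise any isotropic vector will do.\<close>
  obtain v0 where v0: "v0 \<noteq> 0" "Q v0 = 0" "Q p = 0 \<Longrightarrow> v0 = p"
    using p(1) ternary_quadratic_form_isotropic[OF Q(1)] by metis
  obtain m0 m1 m2 k d where M: "det3 m0 m1 m2 \<noteq> 0" "k \<noteq> 0" "m2 = k *s v0" "d \<noteq> 0"
    and Q_eq: "\<And>x y z. Q (x *s m0 + y *s m1 + z *s m2) = d * (y\<^sup>2 - x * z)"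
    by (rule nondegenerate_form_normal_form[OF Q(1,2) v0(1,2)]) blast
  obtain x0 y0 z0 and m :: nat where p_eq: "p = x0 *s m0 + y0 *s m1 + z0 *s m2"
    and m: "y0\<^sup>2 \<noteq> x0 * z0 \<and> m = 2 \<or> x0 = 0 \<and> y0 = 0 \<and> z0 \<noteq> 0 \<and> m = 1"
  proof (cases "Q p = 0")
    case True
    then have "p = 0 *s m0 + 0 *s m1 + inverse k *s m2" using v0(3) M(2,3) by simp
    then show thesis using M(2) by (intro that[of 0 0 "inverse k" 1]) auto
  next
    case False
    obtain x y z where "p = x *s m0 + y *s m1 + z *s m2"
      using det3_combination[OF M(1)] by blast
    then show thesis using False by (intro that[of x y z 2]) (auto simp: Q_eq)
  qed

  have h_lin: "h (u + v) = h u + h v" "h (a *s v) = \<iota> (\<rho> a) *s h v" for u v a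
    by (simp_all add: h_def \<rho>_hom emb_hom vec.scale_left_distrib vec.scale_right_distrib)
  define W0 where "W0 = h m0"
  define W1 where "W1 = h m1"
  define W2 where "W2 = h m2"
  have h_comb: "h (x *s m0 + y *s m1 + z *s m2) = \<iota> (\<rho> x) *s W0 + \<iota> (\<rho> y) *s W1 + \<iota> (\<rho> z) *s W2" for x y z
    by (simp add: h_lin W0_def W1_def W2_def)
  have "det3 W0 W1 W2 = \<iota> (\<rho> (det3 m0 m1 m2)) * det3 A1 A2 A3"
    unfolding W0_def W1_def W2_def h_def det3_linear_combination
    by (simp add: det3_def \<rho>_hom emb_hom)
  then have det_W: "det3 W0 W1 W2 \<noteq> 0"
    using M(1) A by (simp add: emb_eq_0 field_embedding_eq_0[OF \<rho>(1)])
  have ker0: "\<iota> (\<rho> x0) * W0 $ 3 + \<iota> (\<rho> y0) * W1 $ 3 + \<iota> (\<rho> z0) * W2 $ 3 = 0"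
    using tangent[OF p(1)] h_comb[of x0 y0 z0] by (simp flip: p_eq)
  \<comment> \<open>As \<rho> is onto, a relation over \<open>'q\<close> comes from a vector
    \<open>v\<close> with \<open>h v\<close> at infinity, and tangency makes \<open>v\<close> a
    multiple of \<open>p\<close>.\<close>
  have ker: "\<exists>k. u1 = k * \<rho> x0 \<and> u2 = k * \<rho> y0 \<and> u3 = k * \<rho> z0"
    if u: "\<iota> u1 * W0 $ 3 + \<iota> u2 * W1 $ 3 + \<iota> u3 * W2 $ 3 = 0" for u1 u2 u3
  proof -
    obtain x y z where xyz: "u1 = \<rho> x" "u2 = \<rho> y" "u3 = \<rho> z" using \<rho>(2) by (metis surjD)
    define v where "v = x *s m0 + y *s m1 + z *s m2"
    have "\<exists>l. v = l *s p"
    proof (cases "v = 0")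
      case False
      have "h v $ 3 = 0" using u by (simp add: v_def h_comb xyz)
      then have "v \<in> vec.span {p}" using tangent[OF False] vec.span_base[of v "{v}"] by auto
      then show ?thesis by (auto simp: vec.span_singleton)
    qed (auto intro: exI[of _ 0])
    then obtain l where "v = l *s p" by blast
    then have "(x - l * x0) *s m0 + (y - l * y0) *s m1 + (z - l * z0) *s m2 = 0"
      using p_eq by (simp add: v_def vec_eq_iff algebra_simps)
    note zero = det3_independent[OF M(1) this]
    then have "x = l * x0" "y = l * y0" "z = l * z0" by simp_all
    then show ?thesis by (intro exI[of _ "\<rho> l"]) (simp add: xyz \<rho>_hom(4))
  qed
  have m': "(\<rho> y0)\<^sup>2 \<noteq> \<rho> x0 * \<rho> z0 \<and> m = 2 \<or> \<rho> x0 = 0 \<and> \<rho> y0 = 0 \<and> \<rho> z0 \<noteq> 0 \<and> m = 1"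
    using m by (simp add: field_embedding_inj[OF \<rho>(1)] field_embedding_eq_0[OF \<rho>(1)] flip: \<rho>_hom(4,7))

  have "bb_set \<phi> C = (\<Union>P\<in>D. points_in (\<phi> (f P)))"
    by (auto simp: bb_set_def C)
  also have "\<dots> = (\<Union>t. points_in (\<phi> (f (vec.span {m0 + t *s m1 + t\<^sup>2 *s m2}))))
      \<union> points_in (\<phi> (f (vec.span {m2})))"
    unfolding Q(3) nondegenerate_conic_parametrization[OF M(1,4) Q_eq] by blast
  also have "\<dots> = (\<Union>t. points_in (rep (W0 + \<iota> (\<rho> t) *s W1 + (\<iota> (\<rho> t))\<^sup>2 *s W2))) \<union> points_in (rep W2)"
  proof -
    have "m0 + t *s m1 + t\<^sup>2 *s m2 \<noteq> 0" for t
      using det3_independent(1)[OF M(1), of 1 t "t\<^sup>2"] by auto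
    moreover have "h (m0 + t *s m1 + t\<^sup>2 *s m2) = W0 + \<iota> (\<rho> t) *s W1 + (\<iota> (\<rho> t))\<^sup>2 *s W2" for t
      using h_comb[of 1 t "t\<^sup>2"] by (simp add: \<rho>_hom emb_hom)
    moreover have "m2 \<noteq> 0" using M(2,3) v0(1) by simp
    ultimately show ?thesis
      using point unfolding h_def[symmetric] by (simp add: W2_def)
  qed
  \<comment> \<open>The automorphism \<rho> is onto, so replacing \<open>\<rho> t\<close> by
    \<theta> only relabels the parameters.\<close>
  also have "\<dots> = (\<Union>\<theta>. points_in (rep (W0 + \<iota> \<theta> *s W1 + (\<iota> \<theta>)\<^sup>2 *s W2))) \<union> points_in (rep W2)"
  proof -
    have "(\<Union>t. F (\<rho> t)) = (\<Union>\<theta>. F \<theta>)" for F :: "'q \<Rightarrow> ('q ^ 7) set set"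
      using \<rho>(2) by (metis image_image)
    then show ?thesis by (rule arg_cong[of _ _ "\<lambda>Y. Y \<union> points_in (rep W2)"])
  qed
  finally have eq: "bb_set \<phi> C =
    (\<Union>\<theta>. points_in (rep (W0 + \<iota> \<theta> *s W1 + (\<iota> \<theta>)\<^sup>2 *s W2))) \<union> points_in (rep W2)" .
  show ?thesis
    unfolding eq by (rule conic_representation[OF det_W ker0 ker m'])
qed

end
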